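(* Let $f$ and $g$ be distinct bicritical rational maps and suppose there exists $k \in \mathbb{N}$ such that $f^k = g^k$. Then $\mathcal{C}_f = \mathcal{C}_g$ and $\mathcal{V}_f = \mathcal{V}_g$, i.e. $f$ and $g$ have the same critical points and the same critical values.
   Context: A rational map $f:\hat{\mathbb{C}}\to\hat{\mathbb{C}}$ of degree $d\ge 2$ is bicritical if it has exactly two (distinct) critical points. $\mathcal{C}_f$ denotes the set of critical points of $f$ and $\mathcal{V}_f = f(\mathcal{C}_f)$ the set of critical values. $f^k$ denotes the $k$-fold iterate of $f$. *)

theory Defs
  imports "HOL-Analysis.Analysis" "HOL-Computational_Algebra.Polynomial_Factorial"
begin

text \<open>The Riemann sphere: None is the point at infinity, Some z the finite point z.\<close>
type_synonym sphere = "complex option"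

text \<open>The rational map z \<mapsto> p(z)/q(z), extended to the Riemann sphere
  (for coprime p, q with q nonzero).\<close>
definition ratmap :: "complex poly \<Rightarrow> complex poly \<Rightarrow> sphere \<Rightarrow> sphere" where
  "ratmap p q w =
     (case w of
        Some z \<Rightarrow> (if poly q z \<noteq> 0 then Some (poly p z / poly q z) else None)
      | None \<Rightarrow> (if degree p > degree q then None
                 else if degree p = degree q then Some (lead_coeff p / lead_coeff q)
                 else Some 0))"

definition rational_map_deg :: "nat \<Rightarrow> (sphere \<Rightarrow> sphere) \<Rightarrow> bool" where
  "rational_map_deg d F \<longleftrightarrow>
     (\<exists>p q. q \<noteq> 0 \<and> coprime p q \<and> max (degree p) (degree q) = d \<and> F = ratmap p q)"

definition sphere_nbhd :: "sphere \<Rightarrow> real \<Rightarrow> sphere set" where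
  "sphere_nbhd w r =
     (case w of
        Some a \<Rightarrow> Some ` ball a r
      | None \<Rightarrow> insert None (Some ` {z. norm z > 1 / r}))"

definition critical_point :: "(sphere \<Rightarrow> sphere) \<Rightarrow> sphere \<Rightarrow> bool" where
  "critical_point F w \<longleftrightarrow> (\<forall>r>0. \<not> inj_on F (sphere_nbhd w r))"

definition crit_points :: "(sphere \<Rightarrow> sphere) \<Rightarrow> sphere set" where
  "crit_points F = {w. critical_point F w}"

definition crit_values :: "(sphere \<Rightarrow> sphere) \<Rightarrow> sphere set" where
  "crit_values F = F ` crit_points F"

definition bicritical :: "(sphere \<Rightarrow> sphere) \<Rightarrow> bool" where
  "bicritical F \<longleftrightarrow> (\<exists>d\<ge>2. rational_map_deg d F) \<and> card (crit_points F) = 2"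

end

theory Submission
  imports Defs "HOL-Complex_Analysis.Conformal_Mappings"
    "HOL-Computational_Algebra.Fundamental_Theorem_Algebra"
begin

text \<open>
  Riemann-Hurwitz (in the form of the Wronskian p'q - pq', of degree 2d-2 with zeros of order at
  most d-1) gives f = A z^d B with Moebius maps A, B. Put F = f^k = g^k. The set Z of points all of
  whose F-preimages are critical for F consists of the critical values of f, together with a point
  w in case d = 2 and f^-1(w) is the set of critical values. Any Moebius maps with
  f^j \<mu> = \<nu> f^j satisfy \<nu>(Z) = Z for the corresponding set Z, and a \<nu> preserving the critical
  values lifts through f; so the deck transformations of F can be followed down the
  iterates of f. This applies to the deck transformations of g, which belong to F.

  If Z has two points, the critical values agree, and every deck transformation of g preserves
  the critical points of f; if it exchanged them, then for d = 2 each map down the chain, including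
  the identity, would exchange the critical values. If Z has three points, deck(F) = deck(f^2)
  unless w is critical, which settles the critical points in the same way. Different critical values
  would then force f and g to act on the same four points (two critical values, w and a fixed point
  p) as two quadratic Lattes maps with w and one critical value exchanged. For such a map the
  coordinate \<lambda> of w, when the critical values are 0, \<infinity> and p is 1, is a root of
  (\<lambda> + 1)(\<lambda>^2 - 6\<lambda> + 1), and the exchange replaces \<lambda> by 1 - \<lambda>, which is not a root.
\<close>

section \<open>Moebius maps of the sphere\<close>

text \<open>The point with homogeneous coordinates [x : y]; pt 0 0 is junk.\<close>

definition pt :: "complex \<Rightarrow> complex \<Rightarrow> sphere" where
  "pt x y = (if y = 0 then None else Some (x / y))"

lemma pt_cases:
  obtains x y where "x \<noteq> 0 \<or> y \<noteq> 0" "w = pt x y"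
proof (cases w)
  case None
  then have "w = pt 1 0" by (simp add: pt_def)
  then show thesis using that[of 1 0] by simp
next
  case (Some z)
  then have "w = pt z 1" by (simp add: pt_def)
  then show thesis using that[of z 1] by simp
qed

lemma pt_eq_iff:
  assumes "a \<noteq> 0 \<or> b \<noteq> 0" "c \<noteq> 0 \<or> d \<noteq> 0"
  shows "pt a b = pt c d \<longleftrightarrow> a * d = b * c"
  using assms by (auto simp: pt_def field_simps)

lemma pt_scale: "k \<noteq> 0 \<Longrightarrow> pt (k * x) (k * y) = pt x y"
  by (simp add: pt_def)

definition moebius_map :: "complex \<Rightarrow> complex \<Rightarrow> complex \<Rightarrow> complex \<Rightarrow> sphere \<Rightarrow> sphere" where
  "moebius_map a b c d w = (case w of Some z \<Rightarrow> pt (a * z + b) (c * z + d) | None \<Rightarrow> pt a c)"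

text \<open>An invertible matrix has trivial kernel, by its adjugate. This keeps homogeneous
  coordinates away from the junk \<open>pt 0 0\<close>.\<close>

lemma linear_nonzero:
  fixes a b c d x y :: complex
  assumes "a * d - b * c \<noteq> 0" "x \<noteq> 0 \<or> y \<noteq> 0"
  shows "a * x + b * y \<noteq> 0 \<or> c * x + d * y \<noteq> 0"
proof (rule ccontr)
  assume "\<not> ?thesis"
  then have 1: "a * x + b * y = 0" and 2: "c * x + d * y = 0" by auto
  have "(a * d - b * c) * x = d * (a * x + b * y) - b * (c * x + d * y)"
    and "(a * d - b * c) * y = a * (c * x + d * y) - c * (a * x + b * y)"
    by algebra+
  then show False using 1 2 assms by simp
qed

lemma moebius_map_pt:
  assumes "x \<noteq> 0 \<or> y \<noteq> 0"
  shows "moebius_map a b c d (pt x y) = pt (a * x + b * y) (c * x + d * y)"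
proof (cases "y = 0")
  case True
  then have "x \<noteq> 0" using assms by simp
  then show ?thesis using True pt_scale[of x a c] by (simp add: pt_def[of x] moebius_map_def mult.commute)
next
  case False
  have "moebius_map a b c d (pt x y) = pt (a * (x / y) + b) (c * (x / y) + d)"
    using False by (simp add: moebius_map_def pt_def[of x])
  also have "\<dots> = pt (y * (a * (x / y) + b)) (y * (c * (x / y) + d))"
    using False by (simp add: pt_scale)
  also have "\<dots> = pt (a * x + b * y) (c * x + d * y)"
    using False by (simp add: algebra_simps)
  finally show ?thesis .
qed

definition moebius :: "(sphere \<Rightarrow> sphere) \<Rightarrow> bool" where
  "moebius T \<longleftrightarrow> (\<exists>a b c d. a * d - b * c \<noteq> 0 \<and> T = moebius_map a b c d)"

lemma moebiusI: "a * d - b * c \<noteq> 0 \<Longrightarrow> moebius (moebius_map a b c d)"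
  unfolding moebius_def by blast

lemma moebius_map_comp:
  assumes "a' * d' - b' * c' \<noteq> 0"
  shows "moebius_map a b c d \<circ> moebius_map a' b' c' d' =
    moebius_map (a * a' + b * c') (a * b' + b * d') (c * a' + d * c') (c * b' + d * d')"
proof
  fix w
  obtain x y where xy: "x \<noteq> 0 \<or> y \<noteq> 0" "w = pt x y" by (rule pt_cases)
  show "(moebius_map a b c d \<circ> moebius_map a' b' c' d') w =
    moebius_map (a * a' + b * c') (a * b' + b * d') (c * a' + d * c') (c * b' + d * d') w"
    unfolding xy(2) comp_apply moebius_map_pt[OF xy(1)] moebius_map_pt[OF linear_nonzero[OF assms xy(1)]]
    by (simp add: algebra_simps)
qed

lemma moebius_map_scalar:
  assumes "k \<noteq> 0"
  shows "moebius_map k 0 0 k = id"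
proof
  fix w
  obtain x y where "x \<noteq> 0 \<or> y \<noteq> 0" "w = pt x y" by (rule pt_cases)
  then show "moebius_map k 0 0 k w = id w" using assms by (simp add: moebius_map_pt pt_scale)
qed

lemma moebius_id: "moebius id"
  using moebiusI[of 1 1 0 0] moebius_map_scalar[of 1] by simp

lemma moebius_comp:
  assumes "moebius S" "moebius T"
  shows "moebius (S \<circ> T)"
proof -
  obtain a b c d where S: "a * d - b * c \<noteq> 0" "S = moebius_map a b c d"
    using assms(1) moebius_def by auto
  obtain a' b' c' d' where T: "a' * d' - b' * c' \<noteq> 0" "T = moebius_map a' b' c' d'"
    using assms(2) moebius_def by auto
  have "(a * a' + b * c') * (c * b' + d * d') - (a * b' + b * d') * (c * a' + d * c') =
     (a * d - b * c) * (a' * d' - b' * c')" by algebra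
  then show ?thesis using S T by (simp add: moebius_map_comp moebiusI)
qed

lemma moebius_inverse:
  assumes "moebius T"
  shows "bij T" "moebius (inv T)"
proof -
  obtain a b c d where T: "a * d - b * c \<noteq> 0" "T = moebius_map a b c d"
    using assms(1) moebius_def by auto
  let ?U = "moebius_map d (-b) (-c) a"
  have det: "d * a - (- b) * (- c) \<noteq> 0" using T(1) by (simp add: algebra_simps)
  have "moebius_map (d * a + - b * c) 0 0 (- c * b + a * d) = id"
    using T(1) moebius_map_scalar[of "a * d - b * c"] by (simp add: algebra_simps)
  then have 1: "?U \<circ> T = id"
    using moebius_map_comp[OF T(1), of d "-b" "-c" a] by (simp add: T(2) algebra_simps)
  have "moebius_map (a * d + b * - c) 0 0 (c * - b + d * a) = id"
    using T(1) moebius_map_scalar[of "a * d - b * c"] by (simp add: algebra_simps)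
  then have 2: "T \<circ> ?U = id"
    using moebius_map_comp[OF det, of a b c d] by (simp add: T(2) algebra_simps)
  show "bij T" using 1 2 by (rule o_bij)
  have "inv T = ?U" using 1 by (metis 2 inv_unique_comp)
  then show "moebius (inv T)" using det moebiusI by simp
qed

lemma moebius_inv_simps:
  assumes "moebius T"
  shows "inv T (T x) = x" "T (inv T x) = x" "T x = T y \<longleftrightarrow> x = y"
  using moebius_inverse(1)[OF assms]
  by (auto simp: bij_is_inj bij_is_surj surj_f_inv_f dest: bij_is_inj injD)

text \<open>The map is a cross ratio, a multiple of (z - p) / (z - q).\<close>

lemma moebius_exists3:
  assumes "p \<noteq> q" "q \<noteq> r" "p \<noteq> r"
  obtains S where "moebius S" "S p = Some 0" "S q = None" "S r = Some 1"
proof -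
  obtain p1 p2 where p: "p1 \<noteq> 0 \<or> p2 \<noteq> 0" "p = pt p1 p2" by (rule pt_cases)
  obtain q1 q2 where q: "q1 \<noteq> 0 \<or> q2 \<noteq> 0" "q = pt q1 q2" by (rule pt_cases)
  obtain r1 r2 where r: "r1 \<noteq> 0 \<or> r2 \<noteq> 0" "r = pt r1 r2" by (rule pt_cases)
  \<comment> \<open>\<open>k\<close> and \<open>l\<close> scale numerator and denominator so that
    both become \<open>k * l\<close> at \<open>r\<close>.\<close>
  define k l where "k = r1 * q2 - r2 * q1" and "l = r1 * p2 - r2 * p1"
  have k: "k \<noteq> 0" using assms(2) pt_eq_iff[OF q(1) r(1)] q r by (auto simp: k_def algebra_simps)
  have l: "l \<noteq> 0" using assms(3) pt_eq_iff[OF p(1) r(1)] p r by (auto simp: l_def algebra_simps)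
  have m: "p1 * q2 - p2 * q1 \<noteq> 0"
    using assms(1) pt_eq_iff[OF p(1) q(1)] p q by (auto simp: algebra_simps)
  let ?S = "moebius_map (k * p2) (- k * p1) (l * q2) (- l * q1)"
  have "(k * p2) * (- l * q1) - (- k * p1) * (l * q2) = k * l * (p1 * q2 - p2 * q1)" by algebra
  then have "moebius ?S" using k l m by (intro moebiusI) simp
  moreover have "l * (p1 * q2 - p2 * q1) \<noteq> 0" using l m by simp
  then have "?S p = Some 0"
    using p by (auto simp: moebius_map_pt pt_def[of 0] algebra_simps)
  moreover have "?S q = None"
    using q by (auto simp: moebius_map_pt pt_def[of _ 0] algebra_simps)
  moreover have "?S r = Some 1"
  proof -
    have "?S r = pt (k * p2 * r1 + - k * p1 * r2) (l * q2 * r1 + - l * q1 * r2)"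
      using r by (simp only: moebius_map_pt)
    also have "k * p2 * r1 + - k * p1 * r2 = k * l" by (simp add: k_def l_def algebra_simps)
    also have "l * q2 * r1 + - l * q1 * r2 = k * l" by (simp add: k_def l_def algebra_simps)
    finally show ?thesis using k l by (simp add: pt_def)
  qed
  ultimately show thesis by (rule that)
qed

lemma infinite_sphere: "infinite (UNIV :: sphere set)"
  by (metis finite_imageD finite_subset infinite_UNIV_char_0 inj_Some subset_UNIV)

lemma exists_third: "\<exists>r::sphere. r \<noteq> p \<and> r \<noteq> q"
  using ex_new_if_finite[OF infinite_sphere, of "{p, q}"] by auto

lemma moebius_exists2:
  assumes "p \<noteq> q"
  obtains S where "moebius S" "S p = Some 0" "S q = None"
  using exists_third[of p q] moebius_exists3[of p q] assms by metis

abbreviation scale :: "complex \<Rightarrow> sphere \<Rightarrow> sphere" where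
  "scale a \<equiv> moebius_map a 0 0 1"

abbreviation flip :: "complex \<Rightarrow> sphere \<Rightarrow> sphere" where
  "flip a \<equiv> moebius_map 0 a 1 0"

lemma moebius_fix_0_inf:
  assumes "moebius T" "T (Some 0) = Some 0" "T None = None"
  obtains a where "a \<noteq> 0" "T = scale a"
proof -
  obtain a b c d where T: "a * d - b * c \<noteq> 0" "T = moebius_map a b c d"
    using assms(1) moebius_def by auto
  have "c = 0" "b = 0" using assms T by (auto simp: moebius_map_def pt_def split: if_splits)
  then have "a \<noteq> 0" "d \<noteq> 0" using T by auto
  have "T = scale (a / d)"
  proof
    fix w
    obtain x y where "x \<noteq> 0 \<or> y \<noteq> 0" "w = pt x y" by (rule pt_cases)
    then show "T w = scale (a / d) w"
      using T \<open>d \<noteq> 0\<close> \<open>c = 0\<close> \<open>b = 0\<close> by (simp add: moebius_map_pt) (auto simp: pt_def)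
  qed
  then show thesis using that[of "a / d"] \<open>a \<noteq> 0\<close> \<open>d \<noteq> 0\<close> by simp
qed

lemma moebius_flip_0_inf:
  assumes "moebius T" "T (Some 0) = None" "T None = Some 0"
  obtains a where "a \<noteq> 0" "T = flip a"
proof -
  obtain a b c d where T: "a * d - b * c \<noteq> 0" "T = moebius_map a b c d"
    using assms(1) moebius_def by auto
  have "a = 0" "d = 0" using assms T by (auto simp: moebius_map_def pt_def split: if_splits)
  then have "b \<noteq> 0" "c \<noteq> 0" using T by auto
  have "T = flip (b / c)"
  proof
    fix w
    obtain x y where "x \<noteq> 0 \<or> y \<noteq> 0" "w = pt x y" by (rule pt_cases)
    then show "T w = flip (b / c) w"
      using T \<open>c \<noteq> 0\<close> \<open>a = 0\<close> \<open>d = 0\<close> by (simp add: moebius_map_pt) (auto simp: pt_def)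
  qed
  then show thesis using that[of "b / c"] \<open>b \<noteq> 0\<close> \<open>c \<noteq> 0\<close> by simp
qed

text \<open>Conjugation moves the three points to 0, infinity and 1. Fixing 0 and infinity leaves a
  scaling, and fixing 1 makes its factor 1.\<close>

lemma moebius_fix3:
  assumes "moebius T" "T p = p" "T q = q" "T r = r" "p \<noteq> q" "q \<noteq> r" "p \<noteq> r"
  shows "T = id"
proof -
  obtain S where S: "moebius S" "S p = Some 0" "S q = None" "S r = Some 1"
    using moebius_exists3 assms(5-7) by metis
  note i = moebius_inv_simps[OF S(1)]
  let ?U = "S \<circ> T \<circ> inv S"
  have "inv S (Some 0) = p" "inv S None = q" "inv S (Some 1) = r" using i S by metis+
  then have U: "?U (Some 0) = Some 0" "?U None = None" "?U (Some 1) = Some 1"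
    using assms S by simp_all
  have "moebius ?U" by (intro moebius_comp assms S moebius_inverse)
  then obtain a where a: "?U = scale a" using moebius_fix_0_inf U by metis
  then have "scale a (Some 1) = Some 1" using U(3) by simp
  then have "a = 1" by (simp add: moebius_map_def pt_def)
  then have "?U = id" using a moebius_map_scalar[of 1] by simp
  then have "S (T (inv S (S x))) = S x" for x by (metis comp_apply id_apply)
  then show ?thesis using i by (intro ext) simp
qed

text \<open>An induction principle that reduces continuity and substitution into rational functions
  to affine maps and the inversion.\<close>

lemma moebius_generators:
  assumes "moebius T"
    and affine: "\<And>a b. a \<noteq> 0 \<Longrightarrow> P (moebius_map a b 0 1)"
    and inversion: "P (moebius_map 0 1 1 0)"
    and comp: "\<And>S T. P S \<Longrightarrow> P T \<Longrightarrow> P (S \<circ> T)"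
  shows "P T"
proof -
  obtain a b c d where T: "a * d - b * c \<noteq> 0" "T = moebius_map a b c d"
    using assms(1) moebius_def by auto
  have scaled: "T = moebius_map (k * a) (k * b) (k * c) (k * d)" if "k \<noteq> 0" for k
    using moebius_map_comp[OF T(1), of k 0 0 k] moebius_map_scalar[OF that] T(2) by simp
  show ?thesis
  proof (cases "c = 0")
    case True
    then have "a \<noteq> 0" "d \<noteq> 0" using T by auto
    then have "T = moebius_map (a / d) (b / d) 0 1" using scaled[of "1 / d"] True by simp
    then show ?thesis using affine[of "a / d" "b / d"] \<open>a \<noteq> 0\<close> \<open>d \<noteq> 0\<close> by simp
  next
    case False
    \<comment> \<open>This is e in the decomposition (a z + b) / (c z + d) = a / c + e / (c z +
      d).\<close>
    let ?e = "(b * c - a * d) / c"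
    have e: "?e \<noteq> 0" using T False by simp
    have "moebius_map 0 1 1 0 \<circ> moebius_map c d 0 1 = moebius_map 0 1 c d"
      using moebius_map_comp[of c 1 d 0 0 1 1 0] False by simp
    then have "moebius_map ?e (a / c) 0 1 \<circ> (moebius_map 0 1 1 0 \<circ> moebius_map c d 0 1) =
      moebius_map ?e (a / c) 0 1 \<circ> moebius_map 0 1 c d" by simp
    also have "\<dots> = T"
      using moebius_map_comp[of 0 d 1 c ?e "a / c" 0 1] False T(2) by (simp add: field_simps)
    finally show ?thesis
      using comp[OF affine[OF e] comp[OF inversion affine[OF False]]] by metis
  qed
qed

section \<open>Neighbourhoods and critical points\<close>

text \<open>The neighbourhood filters generated by the basic sets of \<open>critical_point\<close>.
  The two characterisations below express them by \<open>nhds\<close> and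
  \<open>at_infinity\<close>, where analytic facts can be quoted.\<close>

definition nbhd_of :: "sphere \<Rightarrow> sphere set \<Rightarrow> bool" where
  "nbhd_of x U \<longleftrightarrow> (\<exists>r>0. sphere_nbhd x r \<subseteq> U)"

lemma nbhd_of_Some: "nbhd_of (Some z) U \<longleftrightarrow> (\<forall>\<^sub>F w in nhds z. Some w \<in> U)"
  unfolding nbhd_of_def sphere_nbhd_def eventually_nhds_metric
  by (auto simp: image_subset_iff dist_commute)

lemma nbhd_of_None: "nbhd_of None U \<longleftrightarrow> None \<in> U \<and> (\<forall>\<^sub>F w in at_infinity. Some w \<in> U)"
proof
  assume "nbhd_of None U"
  then obtain r where r: "r > 0" "None \<in> U" "\<And>z. norm z > 1 / r \<Longrightarrow> Some z \<in> U"
    unfolding nbhd_of_def sphere_nbhd_def by (auto simp: image_subset_iff)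
  have "\<forall>w. 1 / r + 1 \<le> norm w \<longrightarrow> Some w \<in> U" using r(3) by force
  then show "None \<in> U \<and> (\<forall>\<^sub>F w in at_infinity. Some w \<in> U)"
    using r(2) unfolding eventually_at_infinity by blast
next
  assume *: "None \<in> U \<and> (\<forall>\<^sub>F w in at_infinity. Some w \<in> U)"
  then obtain b where "b > 0" "\<forall>w. b \<le> norm w \<longrightarrow> Some w \<in> U"
    unfolding eventually_at_infinity_pos by blast
  then show "nbhd_of None U"
    using * unfolding nbhd_of_def sphere_nbhd_def
    by (intro exI[of _ "1 / b"]) (auto simp: image_subset_iff)
qed

lemma nbhd_of_Int: "nbhd_of x U \<Longrightarrow> nbhd_of x U' \<Longrightarrow> nbhd_of x (U \<inter> U')"
  by (cases x) (auto simp: nbhd_of_Some nbhd_of_None eventually_conj)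

lemma nbhd_of_UNIV: "nbhd_of x UNIV"
  by (cases x) (auto simp: nbhd_of_Some nbhd_of_None)

lemma critical_point_iff: "critical_point F x \<longleftrightarrow> (\<forall>U. nbhd_of x U \<longrightarrow> \<not> inj_on F U)"
  unfolding critical_point_def nbhd_of_def by (meson inj_on_subset order_refl)

lemma not_critical_if_inj: "inj F \<Longrightarrow> \<not> critical_point F x"
  using critical_point_iff nbhd_of_UNIV by blast

section \<open>Continuity and openness on the sphere\<close>

definition sphere_cont :: "(sphere \<Rightarrow> sphere) \<Rightarrow> bool" where
  "sphere_cont T \<longleftrightarrow> (\<forall>x U. nbhd_of (T x) U \<longrightarrow> nbhd_of x (T -` U))"

definition sphere_open :: "(sphere \<Rightarrow> sphere) \<Rightarrow> bool" where
  "sphere_open T \<longleftrightarrow> (\<forall>x U. nbhd_of x U \<longrightarrow> nbhd_of (T x) (T ` U))"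

lemma sphere_cont_comp: "sphere_cont S \<Longrightarrow> sphere_cont T \<Longrightarrow> sphere_cont (S \<circ> T)"
  unfolding sphere_cont_def by (simp add: vimage_comp[symmetric])

lemma sphere_open_comp: "sphere_open S \<Longrightarrow> sphere_open T \<Longrightarrow> sphere_open (S \<circ> T)"
  unfolding sphere_open_def by (metis comp_apply image_comp)

lemma critical_point_comp:
  assumes "sphere_cont G" "sphere_open G"
  shows "critical_point (F \<circ> G) x \<longleftrightarrow> critical_point G x \<or> critical_point F (G x)"
proof
  assume *: "critical_point (F \<circ> G) x"
  show "critical_point G x \<or> critical_point F (G x)"
  proof (rule ccontr)
    assume "\<not> ?thesis"
    then obtain U U' where U: "nbhd_of x U" "inj_on G U" and U': "nbhd_of (G x) U'" "inj_on F U'"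
      unfolding critical_point_iff by blast
    have "nbhd_of x (U \<inter> G -` U')"
      using nbhd_of_Int U(1) U'(1) assms(1) unfolding sphere_cont_def by blast
    moreover have "inj_on (F \<circ> G) (U \<inter> G -` U')"
      using U(2) U'(2) by (auto simp: inj_on_def)
    ultimately show False using * critical_point_iff by blast
  qed
next
  assume *: "critical_point G x \<or> critical_point F (G x)"
  show "critical_point (F \<circ> G) x"
    unfolding critical_point_iff
  proof (intro allI impI notI)
    fix U assume U: "nbhd_of x U" "inj_on (F \<circ> G) U"
    then have "inj_on G U" "inj_on F (G ` U)" by (auto intro: inj_on_imageI2 inj_on_imageI)
    moreover have "nbhd_of (G x) (G ` U)" using assms(2) U(1) unfolding sphere_open_def by blast
    ultimately show False using * U(1) critical_point_iff by blast
  qed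
qed

lemma sphere_cont_affine:
  assumes "a \<noteq> 0"
  shows "sphere_cont (moebius_map a b 0 1)"
  unfolding sphere_cont_def
proof (intro allI impI)
  fix x U assume U: "nbhd_of (moebius_map a b 0 1 x) U"
  show "nbhd_of x (moebius_map a b 0 1 -` U)"
  proof (cases x)
    case None
    have "filterlim (\<lambda>z. a * z + b) at_infinity at_infinity"
      using assms by (intro tendsto_add_filterlim_at_infinity' tendsto_mult_filterlim_at_infinity
        filterlim_ident) (auto intro: tendsto_const)
    then show ?thesis
      using U None by (auto simp: nbhd_of_None moebius_map_def pt_def dest: eventually_compose_filterlim)
  next
    case (Some z)
    have "((\<lambda>z. a * z + b) \<longlongrightarrow> a * z + b) (nhds z)"
      by (intro tendsto_intros filterlim_ident)
    then show ?thesis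
      using U Some by (auto simp: nbhd_of_Some moebius_map_def pt_def dest: eventually_compose_filterlim)
  qed
qed

lemma sphere_cont_inversion: "sphere_cont (moebius_map 0 1 1 0)"
  unfolding sphere_cont_def
proof (intro allI impI)
  fix x U assume U: "nbhd_of (moebius_map 0 1 1 0 x) U"
  have inv: "moebius_map 0 1 1 0 (Some w) = Some (inverse w)" if "w \<noteq> 0" for w
    using that by (simp add: moebius_map_def pt_def field_simps)
  have inv0: "moebius_map 0 1 1 0 (Some 0) = None" "moebius_map 0 1 1 0 None = Some 0"
    by (simp_all add: moebius_map_def pt_def)
  show "nbhd_of x (moebius_map 0 1 1 0 -` U)"
  proof (cases x)
    case None
    have "\<forall>\<^sub>F w in nhds (0::complex). Some w \<in> U" using U None inv0 nbhd_of_Some by simp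
    then have "\<forall>\<^sub>F w::complex in at_infinity. Some (inverse w) \<in> U"
      using eventually_compose_filterlim tendsto_inverse_0 by blast
    moreover have "\<forall>\<^sub>F w::complex in at_infinity. w \<noteq> 0"
      unfolding eventually_at_infinity by (intro exI[of _ 1]) auto
    ultimately have "\<forall>\<^sub>F w::complex in at_infinity. moebius_map 0 1 1 0 (Some w) \<in> U"
      by eventually_elim (simp add: inv)
    moreover have "Some 0 \<in> U" using U None inv0 nbhd_of_Some eventually_nhds_x_imp_x by auto
    ultimately show ?thesis using None inv0 by (simp add: nbhd_of_None)
  next
    case (Some z)
    show ?thesis
    proof (cases "z = 0")
      case True
      have "\<forall>\<^sub>F w::complex in at 0. Some (inverse w) \<in> U"
        using U Some True inv0 filterlim_inverse_at_infinity[where ?'a = complex]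
        by (auto simp: nbhd_of_None dest: eventually_compose_filterlim)
      moreover have "\<forall>\<^sub>F w::complex in at 0. w \<noteq> 0" by (simp add: eventually_at_filter)
      ultimately have "\<forall>\<^sub>F w::complex in at 0. moebius_map 0 1 1 0 (Some w) \<in> U"
        by eventually_elim (simp add: inv)
      then show ?thesis
        using U Some True inv0 by (simp add: nbhd_of_Some nbhd_of_None eventually_nhds_conv_at)
    next
      case False
      have "(inverse \<longlongrightarrow> inverse z) (nhds z)"
        using False by (intro tendsto_inverse filterlim_ident)
      moreover have "\<forall>\<^sub>F w in nhds (inverse z). Some w \<in> U"
        using U Some False inv nbhd_of_Some by simp
      ultimately have "\<forall>\<^sub>F w in nhds z. Some (inverse w) \<in> U"
        using eventually_compose_filterlim by blast
      moreover have "\<forall>\<^sub>F w in nhds z. w \<noteq> 0" using False by (rule t1_space_nhds)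
      ultimately have "\<forall>\<^sub>F w in nhds z. moebius_map 0 1 1 0 (Some w) \<in> U"
        by eventually_elim (simp add: inv)
      then show ?thesis using Some by (simp add: nbhd_of_Some)
    qed
  qed
qed

lemma moebius_sphere_cont: "moebius T \<Longrightarrow> sphere_cont T"
  by (erule moebius_generators) (fact sphere_cont_affine sphere_cont_inversion sphere_cont_comp)+

lemma moebius_sphere_open:
  assumes "moebius T"
  shows "sphere_open T"
proof -
  have "T ` U = inv T -` U" for U
    using moebius_inverse(1)[OF assms] by (simp add: bij_vimage_eq_inv_image bij_imp_bij_inv inv_inv_eq)
  moreover have "sphere_cont (inv T)" using moebius_sphere_cont moebius_inverse(2) assms by blast
  ultimately show ?thesis
    unfolding sphere_open_def sphere_cont_def using moebius_inv_simps[OF assms] by simp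
qed

lemma moebius_not_critical: "moebius T \<Longrightarrow> \<not> critical_point T x"
  using moebius_inverse(1) not_critical_if_inj bij_is_inj by blast

section \<open>The power map\<close>

definition sphere_pow :: "nat \<Rightarrow> sphere \<Rightarrow> sphere" where
  "sphere_pow d w = (case w of Some z \<Rightarrow> Some (z ^ d) | None \<Rightarrow> None)"

lemma sphere_pow_simps [simp]:
  "sphere_pow d (Some z) = Some (z ^ d)" "sphere_pow d None = None"
  by (simp_all add: sphere_pow_def)

lemma sphere_pow_pt: "d > 0 \<Longrightarrow> sphere_pow d (pt x y) = pt (x ^ d) (y ^ d)"
  by (simp add: pt_def power_divide)

lemma complex_root_exists:
  assumes "d > 0"
  obtains z :: complex where "z ^ d = w"
proof (cases "w = 0")
  case True
  then show thesis using that[of 0] assms by simp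
next
  case False
  then have "exp (Ln w / of_nat d) ^ d = w"
    using assms by (simp add: exp_of_nat_mult[symmetric])
  then show thesis by (rule that)
qed

lemma sphere_pow_cont:
  assumes "d > 0"
  shows "sphere_cont (sphere_pow d)"
  unfolding sphere_cont_def
proof (intro allI impI)
  fix x U assume U: "nbhd_of (sphere_pow d x) U"
  show "nbhd_of x (sphere_pow d -` U)"
  proof (cases x)
    case None
    have "filterlim (\<lambda>z::complex. z ^ d) at_infinity at_infinity"
      using assms by (intro filterlim_power_at_infinity filterlim_ident) auto
    then show ?thesis
      using U None by (auto simp: nbhd_of_None dest: eventually_compose_filterlim)
  next
    case (Some z)
    have "((\<lambda>z. z ^ d) \<longlongrightarrow> z ^ d) (nhds z)" by (intro tendsto_intros filterlim_ident)
    then show ?thesis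
      using U Some by (auto simp: nbhd_of_Some dest: eventually_compose_filterlim)
  qed
qed

text \<open>At infinity, roots of large numbers are large; at a finite point the open mapping
  theorem applies.\<close>

lemma sphere_pow_open:
  assumes "d > 0"
  shows "sphere_open (sphere_pow d)"
  unfolding sphere_open_def
proof (intro allI impI)
  fix x U assume U: "nbhd_of x U"
  show "nbhd_of (sphere_pow d x) (sphere_pow d ` U)"
  proof (cases x)
    case None
    then obtain b where b: "b > 0" "\<And>w. b \<le> norm w \<Longrightarrow> Some w \<in> U"
      using U by (auto simp: nbhd_of_None eventually_at_infinity_pos)
    have "Some w \<in> sphere_pow d ` U" if "b ^ d \<le> norm w" for w
    proof -
      obtain z where z: "z ^ d = w" using complex_root_exists assms by blast
      then have "b ^ d \<le> norm z ^ d" using that by (metis norm_power)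
      then have "b \<le> norm z" using assms by (simp add: power_mono_iff b(1) less_imp_le)
      then show ?thesis using z b(2) by (intro image_eqI[of _ _ "Some z"]) auto
    qed
    then have "\<forall>\<^sub>F w in at_infinity. Some w \<in> sphere_pow d ` U"
      unfolding eventually_at_infinity by blast
    moreover have "None \<in> sphere_pow d ` U"
      using U None by (intro image_eqI[of _ _ None]) (auto simp: nbhd_of_None)
    ultimately show ?thesis using None by (simp add: nbhd_of_None)
  next
    case (Some z)
    then obtain X where X: "open X" "z \<in> X" "\<And>w. w \<in> X \<Longrightarrow> Some w \<in> U"
      using U by (auto simp: nbhd_of_Some eventually_nhds)
    have "\<not> (\<lambda>z::complex. z ^ d) constant_on UNIV"
    proof
      assume "(\<lambda>z::complex. z ^ d) constant_on UNIV"
      then have "(0::complex) ^ d = 1 ^ d" unfolding constant_on_def by (metis UNIV_I)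
      then show False using assms by (simp add: zero_power)
    qed
    then have "open ((\<lambda>z. z ^ d) ` X)"
      using X(1) by (intro open_mapping_thm[of _ UNIV]) (auto intro!: holomorphic_intros)
    moreover have "Some w \<in> sphere_pow d ` U" if "w \<in> (\<lambda>z. z ^ d) ` X" for w
      using that X(3) by (auto intro!: image_eqI[of _ _ "Some _"])
    ultimately show ?thesis
      using Some X(2) by (auto simp: nbhd_of_Some eventually_nhds intro!: exI[of _ "(\<lambda>z. z ^ d) ` X"])
  qed
qed

text \<open>The root is exp(2 pi i / d). The last clause separates degree 2 from higher degrees: for
  d \<ge> 3 the rotation by \<zeta> is not an involution.\<close>

lemma primitive_root:
  assumes "d \<ge> 2"
  obtains \<zeta> :: complex where "\<zeta> ^ d = 1" "\<zeta> \<noteq> 1" "d \<ge> 3 \<Longrightarrow> \<zeta>\<^sup>2 \<noteq> 1"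
proof -
  define \<zeta> where "\<zeta> = cis (2 * pi / d)"
  have "\<zeta> ^ d = cis (real d * (2 * pi / real d))" unfolding \<zeta>_def by (rule Complex.DeMoivre)
  then have "\<zeta> ^ d = 1" using assms by simp
  moreover have "\<zeta> \<noteq> 1"
  proof
    assume "\<zeta> = 1"
    then have "sin (2 * pi / d) = 0" "cos (2 * pi / d) = 1"
      by (simp_all add: \<zeta>_def complex_eq_iff)
    then have "d = 2 \<or> d \<ge> 3" "sin (2 * pi / d) = 0" "cos (2 * pi / d) = 1" using assms by auto
    moreover have "sin (2 * pi / d) > 0" if "d \<ge> 3"
      using that by (intro sin_gt_zero) (auto simp: field_simps)
    ultimately show False by auto
  qed
  moreover have "\<zeta>\<^sup>2 \<noteq> 1" if "d \<ge> 3"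
  proof
    assume "\<zeta>\<^sup>2 = 1"
    then have "\<zeta> = 1 \<or> \<zeta> = -1" by (simp add: power2_eq_1_iff)
    then have "sin (2 * pi / d) = 0" by (auto simp: \<zeta>_def complex_eq_iff)
    moreover have "sin (2 * pi / d) > 0"
      using that by (intro sin_gt_zero) (auto simp: field_simps)
    ultimately show False by simp
  qed
  ultimately show thesis by (rule that)
qed

text \<open>Near 0 and infinity, w and \<zeta> w are two points of equal modulus with the same
  power. Elsewhere the derivative is nonzero.\<close>

lemma critical_point_sphere_pow:
  assumes "d \<ge> 2"
  shows "critical_point (sphere_pow d) x \<longleftrightarrow> x = Some 0 \<or> x = None"
proof -
  obtain \<zeta> :: complex where z: "\<zeta> ^ d = 1" "\<zeta> \<noteq> 1" using primitive_root assms by metis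
  have "norm \<zeta> ^ d = 1 ^ d" using z(1) by (metis norm_one norm_power power_one)
  then have n: "norm \<zeta> = 1" using assms by (subst (asm) power_eq_iff_eq_base) auto
  have *: "\<not> inj_on (sphere_pow d) U" if "w \<noteq> 0" "Some w \<in> U" "Some (\<zeta> * w) \<in> U" for w U
  proof
    assume "inj_on (sphere_pow d) U"
    moreover have "sphere_pow d (Some (\<zeta> * w)) = sphere_pow d (Some w)"
      using z by (simp add: power_mult_distrib)
    ultimately have "Some (\<zeta> * w) = Some w" by (meson inj_onD that(2,3))
    then show False using that(1) z by simp
  qed
  show ?thesis
  proof (cases x)
    case None
    have "\<not> inj_on (sphere_pow d) U" if U: "nbhd_of None U" for U
    proof -
      obtain b where b: "b > 0" "\<And>w. b \<le> norm w \<Longrightarrow> Some w \<in> U"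
        using U by (auto simp: nbhd_of_None eventually_at_infinity_pos)
      show ?thesis using b n by (intro *[of "of_real b"]) (auto simp: norm_mult)
    qed
    then show ?thesis using None by (simp add: critical_point_iff)
  next
    case (Some u)
    show ?thesis
    proof (cases "u = 0")
      case True
      have "\<not> inj_on (sphere_pow d) U" if U: "nbhd_of (Some 0) U" for U
      proof -
        obtain r where r: "r > 0" "\<And>w. norm w < r \<Longrightarrow> Some w \<in> U"
          using U by (auto simp: nbhd_of_Some eventually_nhds_metric)
        show ?thesis using r n by (intro *[of "of_real (r / 2)"]) (auto simp: norm_mult)
      qed
      then show ?thesis using Some True by (simp add: critical_point_iff)
    next
      case False
      have "((\<lambda>z. z ^ d) has_field_derivative of_nat d * u ^ (d - 1)) (at u)"
        by (auto intro!: derivative_eq_intros)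
      moreover have "of_nat d * u ^ (d - 1) \<noteq> 0" using False assms by simp
      ultimately have "deriv (\<lambda>z. z ^ d) u \<noteq> 0" by (simp add: DERIV_imp_deriv)
      moreover have "(\<lambda>z::complex. z ^ d) holomorphic_on UNIV" by (intro holomorphic_intros)
      ultimately obtain r where r: "r > 0" "inj_on (\<lambda>z. z ^ d) (ball u r)"
        using has_complex_derivative_locally_injective[of "\<lambda>z. z ^ d" UNIV u] by auto
      then have "inj_on (sphere_pow d) (Some ` ball u r)"
        by (auto simp: inj_on_def)
      moreover have "nbhd_of (Some u) (Some ` ball u r)"
        using r(1) unfolding nbhd_of_def sphere_nbhd_def by auto
      ultimately show ?thesis using Some False by (auto simp: critical_point_iff)
    qed
  qed
qed

section \<open>Rational functions and the normal form\<close>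

text \<open>The last two conjuncts exclude common zeros at finite points and at infinity of the
  homogenisations of p and q of degree d; q = 0 is allowed.\<close>

definition rat_rep :: "nat \<Rightarrow> complex poly \<Rightarrow> complex poly \<Rightarrow> bool" where
  "rat_rep d p q \<longleftrightarrow> degree p \<le> d \<and> degree q \<le> d \<and>
     (\<forall>z. poly p z \<noteq> 0 \<or> poly q z \<noteq> 0) \<and> (coeff p d \<noteq> 0 \<or> coeff q d \<noteq> 0)"

text \<open>The value at infinity is that of the forms of degree \<open>d\<close>, hence the
  coefficients at \<open>d\<close> and not the leading ones.\<close>

definition rat_fun :: "nat \<Rightarrow> complex poly \<Rightarrow> complex poly \<Rightarrow> sphere \<Rightarrow> sphere" where
  "rat_fun d p q w =
     (case w of Some z \<Rightarrow> pt (poly p z) (poly q z) | None \<Rightarrow> pt (coeff p d) (coeff q d))"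

lemma rat_fun_simps [simp]:
  "rat_fun d p q (Some z) = pt (poly p z) (poly q z)"
  "rat_fun d p q None = pt (coeff p d) (coeff q d)"
  by (simp_all add: rat_fun_def)

lemma rational_map_deg_rat_fun:
  assumes "rational_map_deg d F" "d \<ge> 1"
  obtains p q where "rat_rep d p q" "F = rat_fun d p q"
proof -
  obtain p q where pq: "q \<noteq> 0" "coprime p q" "max (degree p) (degree q) = d" "F = ratmap p q"
    using assms(1) unfolding rational_map_deg_def by blast
  have "poly p z \<noteq> 0 \<or> poly q z \<noteq> 0" for z
    using coprime_poly_0[OF pq(2)] by auto
  moreover have top: "coeff p d \<noteq> 0 \<or> coeff q d \<noteq> 0"
    using pq(3) assms(2) by (auto simp: max_def split: if_splits)
  ultimately have "rat_rep d p q" using pq(3) by (auto simp: rat_rep_def)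
  moreover have "F w = rat_fun d p q w" for w
  proof (cases w)
    case None
    have "coeff q d = 0" if "degree p > degree q" using that pq(3) by (auto simp: coeff_eq_0)
    moreover have "coeff p d = 0" if "degree p < degree q" using that pq(3) by (auto simp: coeff_eq_0)
    ultimately show ?thesis
      using None pq top by (auto simp: ratmap_def pt_def max_def split: if_splits)
  next
    case (Some z)
    then show ?thesis using pq by (simp add: ratmap_def pt_def)
  qed
  ultimately show thesis using that by blast
qed

section \<open>Composition of rational functions and the identity theorem\<close>

definition rational_fun :: "(sphere \<Rightarrow> sphere) \<Rightarrow> bool" where
  "rational_fun F \<longleftrightarrow> (\<exists>d p q. rat_rep d p q \<and> F = rat_fun d p q)"

lemma rational_fun_id: "rational_fun id"
proof -
  have "rat_rep 1 [:0, 1:] 1" by (simp add: rat_rep_def)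
  moreover have "id w = rat_fun 1 [:0, 1:] 1 w" for w
    by (cases w) (auto simp: pt_def)
  ultimately show ?thesis unfolding rational_fun_def by blast
qed

lemma rat_fun_moebius:
  assumes "moebius T" "rat_rep d p q"
  obtains p' q' where "rat_rep d p' q'" "T \<circ> rat_fun d p q = rat_fun d p' q'"
proof -
  obtain a b c e where T: "a * e - b * c \<noteq> 0" "T = moebius_map a b c e"
    using assms(1) moebius_def by auto
  let ?p = "smult a p + smult b q" and ?q = "smult c p + smult e q"
  have "degree ?p \<le> d" "degree ?q \<le> d"
    using assms(2) by (auto simp: rat_rep_def intro!: degree_add_le order_trans[OF degree_smult_le])
  then have "rat_rep d ?p ?q"
    using assms(2) linear_nonzero[OF T(1)] by (simp add: rat_rep_def)
  moreover have "(T \<circ> rat_fun d p q) w = rat_fun d ?p ?q w" for w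
    using assms(2) T(2) by (cases w) (auto simp: moebius_map_pt rat_rep_def)
  ultimately show thesis using that by blast
qed

lemma rational_fun_moebius_comp: "moebius T \<Longrightarrow> rational_fun G \<Longrightarrow> rational_fun (T \<circ> G)"
  unfolding rational_fun_def by (metis rat_fun_moebius)

lemma moebius_rational_fun: "moebius T \<Longrightarrow> rational_fun T"
  using rational_fun_moebius_comp[OF _ rational_fun_id] by simp

lemma coeff_mult_top:
  fixes p q :: "'a :: comm_semiring_0 poly"
  assumes "degree p \<le> m" "degree q \<le> n"
  shows "coeff (p * q) (m + n) = coeff p m * coeff q n"
proof (cases "degree p = m \<and> degree q = n")
  case True
  then show ?thesis using coeff_mult_degree_sum[of p q] by simp
next
  case False
  then have "degree p + degree q < m + n" "degree p < m \<or> degree q < n" using assms by auto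
  then have "degree (p * q) < m + n" using degree_mult_le[of p q] by linarith
  then show ?thesis using \<open>degree p < m \<or> degree q < n\<close> by (auto simp: coeff_eq_0)
qed

lemma coeff_power_top:
  fixes p :: "'a :: comm_semiring_1 poly"
  assumes "degree p \<le> m"
  shows "coeff (p ^ n) (n * m) = coeff p m ^ n \<and> degree (p ^ n) \<le> n * m"
proof (induction n)
  case (Suc n)
  have "degree (p * p ^ n) \<le> m + n * m"
    using degree_mult_le[of p "p ^ n"] Suc assms by linarith
  then show ?case using Suc assms coeff_mult_top[of p m "p ^ n" "n * m"] by simp
qed simp

lemma rational_fun_pow_comp:
  assumes "n > 0" "rational_fun G"
  shows "rational_fun (sphere_pow n \<circ> G)"
proof -
  obtain d p q where G: "rat_rep d p q" "G = rat_fun d p q"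
    using assms(2) rational_fun_def by auto
  have "rat_rep (n * d) (p ^ n) (q ^ n)"
    using G(1) coeff_power_top[of p d n] coeff_power_top[of q d n] by (auto simp: rat_rep_def)
  moreover have "(sphere_pow n \<circ> G) w = rat_fun (n * d) (p ^ n) (q ^ n) w" for w
    using G coeff_power_top[of p d n] coeff_power_top[of q d n] assms(1)
    by (cases w) (auto simp: sphere_pow_pt rat_rep_def)
  ultimately show ?thesis unfolding rational_fun_def by blast
qed

text \<open>Agreement at a finite point is a root of p s - q r, so infinitely many agreements make
  this polynomial zero. Its coefficient of degree d + e then gives agreement at infinity.\<close>

lemma rational_fun_eqI:
  assumes "rational_fun F" "rational_fun G" "infinite {w. F w = G w}"
  shows "F = G"
proof -
  obtain d p q where F: "rat_rep d p q" "F = rat_fun d p q"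
    using assms(1) rational_fun_def by auto
  obtain e r s where G: "rat_rep e r s" "G = rat_fun e r s"
    using assms(2) rational_fun_def by auto
  let ?D = "p * s - q * r"
  have eq: "F (Some z) = G (Some z) \<longleftrightarrow> poly ?D z = 0" for z
    using F G by (auto simp: rat_rep_def pt_eq_iff)
  have "{w. F w = G w} \<subseteq> insert None (Some ` {z. poly ?D z = 0})"
  proof
    fix w assume "w \<in> {w. F w = G w}"
    then show "w \<in> insert None (Some ` {z. poly ?D z = 0})" using eq by (cases w) auto
  qed
  then have "infinite {z. poly ?D z = 0}" using assms(3) finite_subset by blast
  then have D: "?D = 0" using poly_roots_finite by blast
  have "F w = G w" for w
  proof (cases w)
    case None
    have "coeff (p * s) (d + e) = coeff (q * r) (d + e)" using D by simp
    then have "coeff p d * coeff s e = coeff q d * coeff r e"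
      using F(1) G(1) by (simp add: coeff_mult_top rat_rep_def)
    then show ?thesis using None F G by (auto simp: pt_eq_iff rat_rep_def)
  next
    case (Some z)
    then show ?thesis using D eq by simp
  qed
  then show ?thesis by blast
qed

text \<open>This is z^d p(1/z), the form of degree \<open>d\<close> in the chart at infinity.
  \<open>reflect_poly\<close> reverses with respect to the actual degree; the monomial makes up the
  difference.\<close>

definition reversal :: "nat \<Rightarrow> complex poly \<Rightarrow> complex poly" where
  "reversal d p = monom 1 (d - degree p) * reflect_poly p"

lemma coeff_reversal:
  assumes "degree p \<le> d"
  shows "coeff (reversal d p) n = (if n \<le> d then coeff p (d - n) else 0)"
  using assms unfolding reversal_def
  by (auto simp: coeff_monom_mult coeff_reflect_poly coeff_eq_0)

lemma degree_reversal: "degree p \<le> d \<Longrightarrow> degree (reversal d p) \<le> d"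
  by (intro degree_le) (simp add: coeff_reversal)

lemma poly_reversal:
  assumes "degree p \<le> d" "z \<noteq> 0"
  shows "poly (reversal d p) z = z ^ d * poly p (inverse z)"
  using assms unfolding reversal_def
  by (simp add: poly_monom poly_reflect_poly_nz power_add[symmetric] mult.assoc[symmetric])

lemma poly_reversal_0: "degree p \<le> d \<Longrightarrow> poly (reversal d p) 0 = coeff p d"
  by (simp add: poly_0_coeff_0 coeff_reversal)

lemma rat_rep_reversal:
  assumes "rat_rep d p q"
  shows "rat_rep d (reversal d p) (reversal d q)"
proof -
  have "poly (reversal d p) z \<noteq> 0 \<or> poly (reversal d q) z \<noteq> 0" for z
    using assms by (cases "z = 0") (auto simp: rat_rep_def poly_reversal poly_reversal_0)
  moreover have "coeff p 0 \<noteq> 0 \<or> coeff q 0 \<noteq> 0"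
    using assms by (simp add: rat_rep_def poly_0_coeff_0[symmetric])
  ultimately show ?thesis
    using assms by (simp add: rat_rep_def degree_reversal coeff_reversal)
qed

lemma rat_fun_reversal:
  assumes "rat_rep d p q"
  shows "rat_fun d p q \<circ> moebius_map 0 1 1 0 = rat_fun d (reversal d p) (reversal d q)"
proof
  fix w
  have deg: "degree p \<le> d" "degree q \<le> d" using assms by (auto simp: rat_rep_def)
  show "(rat_fun d p q \<circ> moebius_map 0 1 1 0) w = rat_fun d (reversal d p) (reversal d q) w"
  proof (cases w)
    case None
    then show ?thesis
      by (simp add: moebius_map_def pt_def[of 0 1] coeff_reversal deg poly_0_coeff_0)
  next
    case (Some z)
    show ?thesis
    proof (cases "z = 0")
      case True
      then show ?thesis using Some
        by (simp add: moebius_map_def pt_def[of 1 0] poly_reversal_0 deg)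
    next
      case False
      then show ?thesis using Some
        by (simp add: moebius_map_def pt_def[of 1 z] poly_reversal deg pt_scale inverse_eq_divide)
    qed
  qed
qed

lemma coeff_pcompose_affine:
  fixes p :: "complex poly"
  assumes "degree p \<le> d" "a \<noteq> 0"
  shows "coeff (pcompose p [:b, a:]) d = coeff p d * a ^ d"
proof (cases "degree p = d")
  case True
  then show ?thesis using lead_coeff_comp[of "[:b, a:]" p] assms by (simp add: degree_pcompose)
next
  case False
  then show ?thesis using assms by (simp add: coeff_eq_0 degree_pcompose)
qed

text \<open>Only the generators need an argument: affine maps act by \<open>pcompose\<close>, the
  inversion by \<open>reversal\<close>.\<close>

lemma rat_fun_comp_moebius:
  assumes "moebius T" "rat_rep d p q"
  obtains p' q' where "rat_rep d p' q'" "rat_fun d p q \<circ> T = rat_fun d p' q'"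
proof -
  have "\<forall>p q. rat_rep d p q \<longrightarrow> (\<exists>p' q'. rat_rep d p' q' \<and> rat_fun d p q \<circ> T = rat_fun d p' q')"
    using assms(1)
  proof (rule moebius_generators)
    fix a b :: complex assume a: "a \<noteq> 0"
    show "\<forall>p q. rat_rep d p q \<longrightarrow>
      (\<exists>p' q'. rat_rep d p' q' \<and> rat_fun d p q \<circ> moebius_map a b 0 1 = rat_fun d p' q')"
    proof (intro allI impI)
      fix p q assume r: "rat_rep d p q"
      let ?p = "pcompose p [:b, a:]" and ?q = "pcompose q [:b, a:]"
      have c: "coeff ?p d = a ^ d * coeff p d" "coeff ?q d = a ^ d * coeff q d"
        using r a by (simp_all add: coeff_pcompose_affine rat_rep_def)
      have "rat_rep d ?p ?q"
        using r a by (simp add: rat_rep_def poly_pcompose degree_pcompose coeff_pcompose_affine)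
      moreover have "(rat_fun d p q \<circ> moebius_map a b 0 1) w = rat_fun d ?p ?q w" for w
      proof (cases w)
        case None
        then show ?thesis using a by (simp add: moebius_map_def pt_def[of _ 0] c pt_scale)
      next
        case (Some z)
        then show ?thesis
          by (simp add: moebius_map_def pt_def[of _ 1] poly_pcompose add.commute mult.commute)
      qed
      ultimately show "\<exists>p' q'. rat_rep d p' q' \<and> rat_fun d p q \<circ> moebius_map a b 0 1 = rat_fun d p' q'"
        by blast
    qed
  next
    show "\<forall>p q. rat_rep d p q \<longrightarrow>
      (\<exists>p' q'. rat_rep d p' q' \<and> rat_fun d p q \<circ> moebius_map 0 1 1 0 = rat_fun d p' q')"
      using rat_rep_reversal rat_fun_reversal by blast
  next
    fix S T :: "sphere \<Rightarrow> sphere"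
    assume "\<forall>p q. rat_rep d p q \<longrightarrow> (\<exists>p' q'. rat_rep d p' q' \<and> rat_fun d p q \<circ> S = rat_fun d p' q')"
      and "\<forall>p q. rat_rep d p q \<longrightarrow> (\<exists>p' q'. rat_rep d p' q' \<and> rat_fun d p q \<circ> T = rat_fun d p' q')"
    then show "\<forall>p q. rat_rep d p q \<longrightarrow>
        (\<exists>p' q'. rat_rep d p' q' \<and> rat_fun d p q \<circ> (S \<circ> T) = rat_fun d p' q')"
      unfolding comp_assoc[symmetric] by metis
  qed
  then show thesis using assms(2) that by blast
qed

section \<open>Wronskians and the Riemann-Hurwitz count\<close>

definition wronskian :: "complex poly \<Rightarrow> complex poly \<Rightarrow> complex poly" where
  "wronskian p q = pderiv p * q - p * pderiv q"

text \<open>An injective holomorphic function has nonzero derivative, and the derivative of p / q is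
  the Wronskian divided by q^2.\<close>

lemma wronskian_nonzero:
  assumes "rat_rep d p q" "\<not> critical_point (rat_fun d p q) (Some z)"
  shows "poly (wronskian p q) z \<noteq> 0"
proof -
  have main: "poly (wronskian p q) z \<noteq> 0"
    if q: "poly q z \<noteq> 0" and U: "nbhd_of (Some z) U" "inj_on (rat_fun d p q) U" for p q U
  proof -
    obtain X where X: "open X" "z \<in> X" "\<And>w. w \<in> X \<Longrightarrow> Some w \<in> U"
      using U(1) by (auto simp: nbhd_of_Some eventually_nhds)
    define Y where "Y = X - {w. poly q w = 0}"
    have "q \<noteq> 0" using q by auto
    then have Y: "open Y" "z \<in> Y"
      unfolding Y_def using X q poly_roots_finite[of q] by (auto intro!: open_Diff finite_imp_closed)
    have "(\<lambda>w. poly p w / poly q w) holomorphic_on Y"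
      by (auto simp: Y_def intro!: holomorphic_intros)
    moreover have "inj_on (\<lambda>w. poly p w / poly q w) Y"
    proof (rule inj_onI)
      fix v w assume vw: "v \<in> Y" "w \<in> Y" "poly p v / poly q v = poly p w / poly q w"
      then have "rat_fun d p q (Some v) = rat_fun d p q (Some w)"
        by (simp add: Y_def pt_def)
      moreover have "Some v \<in> U" "Some w \<in> U" using vw X Y_def by auto
      ultimately show "v = w" using U(2) by (metis inj_onD option.inject)
    qed
    ultimately have "deriv (\<lambda>w. poly p w / poly q w) z \<noteq> 0"
      using holomorphic_injective_imp_regular Y by blast
    moreover have "((\<lambda>w. poly p w / poly q w) has_field_derivative
        poly (wronskian p q) z / (poly q z)\<^sup>2) (at z)"
      using q by (auto intro!: derivative_eq_intros simp: wronskian_def power2_eq_square)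
    ultimately show ?thesis by (auto dest: DERIV_imp_deriv)
  qed
  obtain U where U: "nbhd_of (Some z) U" "inj_on (rat_fun d p q) U"
    using assms(2) critical_point_iff by blast
  show ?thesis
  proof (cases "poly q z = 0")
    case False
    then show ?thesis using main U by blast
  next
    case True
    \<comment> \<open>At a pole the reciprocal q / p is used; its Wronskian is the negative.\<close>
    have "moebius_map 0 1 1 0 (rat_fun d p q w) = rat_fun d q p w" for w
      using assms(1) by (cases w) (auto simp: rat_rep_def moebius_map_pt)
    then have "rat_fun d q p = moebius_map 0 1 1 0 \<circ> rat_fun d p q" by (simp add: fun_eq_iff)
    moreover have "inj (moebius_map 0 1 1 0)"
      using moebius_inverse(1) moebiusI[of 0 0 1 1] by (simp add: bij_is_inj)
    ultimately have "inj_on (rat_fun d q p) U"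
      using U(2) by (simp add: comp_inj_on inj_on_subset)
    moreover have "poly p z \<noteq> 0" using True assms(1) rat_rep_def by blast
    ultimately have "poly (wronskian q p) z \<noteq> 0" using main U(1) by blast
    then show ?thesis by (simp add: wronskian_def algebra_simps)
  qed
qed

text \<open>Once the largest power of the variable is split off, no root remains, and the
  fundamental theorem of algebra makes the cofactor constant.\<close>

lemma poly_only_root_0:
  fixes P :: "complex poly"
  assumes "\<And>z. z \<noteq> 0 \<Longrightarrow> poly P z \<noteq> 0"
  obtains c m where "c \<noteq> 0" "P = monom c m"
proof -
  have "P \<noteq> 0" using assms[of 1] by auto
  then obtain m R where R: "P = [:0, 1:] ^ m * R" "\<not> [:0, 1:] dvd R"
    using order_decomp[of P 0] by auto
  have "poly R z \<noteq> 0" for z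
  proof (cases "z = 0")
    case True
    then show ?thesis using R(2) poly_eq_0_iff_dvd[of R 0] by simp
  next
    case False
    then show ?thesis using assms[of z] unfolding R(1) by simp
  qed
  then have "constant (poly R)" 
    using Fundamental_Theorem_Algebra.fundamental_theorem_of_algebra[of R] by auto
  then have "degree R = 0" by (simp add: constant_degree)
  then obtain c where c: "R = [:c:]" by (rule degree_eq_zeroE)
  then have "P = monom c m"
    using R(1) by (simp add: monom_altdef)
  moreover have "c \<noteq> 0" using c R(2) by auto
  ultimately show thesis using that by blast
qed

text \<open>Where q does not vanish, a zero of p of order e + 1 is a zero of the Wronskian of order
  exactly e; hence e = m.\<close>

lemma order_wronskian:
  assumes "poly p 0 = 0" "poly q 0 \<noteq> 0" "wronskian p q = monom c m" "c \<noteq> 0"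
  obtains r where "p = monom 1 (Suc m) * r" "r \<noteq> 0"
proof -
  have "p \<noteq> 0" using assms(3,4) by (auto simp: wronskian_def)
  then obtain r where r: "p = [:0, 1:] ^ order 0 p * r" "\<not> [:0, 1:] dvd r"
    using order_decomp[of p 0] by auto
  obtain e where e: "order 0 p = Suc e"
    using assms(1) \<open>p \<noteq> 0\<close> order_root by (metis not0_implies_Suc)
  let ?X = "[:0, 1:] :: complex poly"
  have r0: "poly r 0 \<noteq> 0" using r(2) poly_eq_0_iff_dvd[of r 0] by simp
  have dX: "pderiv (?X ^ Suc e) = smult (of_nat (Suc e)) (?X ^ e)"
    by (simp add: pderiv_power_Suc pderiv_pCons del: power_Suc)
  \<comment> \<open>\<open>K\<close> is the cofactor of z^e in the Wronskian, with K(0) = (e + 1)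
    r(0) q(0) nonzero.\<close>
  define K where "K = smult (of_nat (Suc e)) (r * q) + ?X * (pderiv r * q - r * pderiv q)"
  have p: "p = ?X ^ Suc e * r" using r(1) e by simp
  have "wronskian p q = ?X ^ e * K"
    unfolding wronskian_def p pderiv_mult dX K_def by (simp add: algebra_simps)
  then have *: "?X ^ e * K = ?X ^ m * [:c:]" using assms(3) by (simp add: monom_altdef)
  have K0: "poly K 0 \<noteq> 0" using r0 assms(2) by (simp add: K_def del: of_nat_Suc)
  have ord: "order 0 (?X ^ n * L) = n" if "poly L 0 \<noteq> 0" for n L
  proof -
    have "L \<noteq> 0" using that by auto
    then have "order 0 (?X ^ n * L) = order 0 (?X ^ n) + order 0 L"
      by (intro order_mult) simp
    moreover have "order 0 (?X ^ n) = n" using order_power_n_n[of "0::complex" n] by simp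
    moreover have "order 0 L = 0" using that by (simp add: order_root)
    ultimately show ?thesis by simp
  qed
  have "e = m" using ord[of K e] ord[of "[:c:]" m] K0 assms(4) * by simp
  then have "p = monom 1 (Suc m) * r" using p by (simp add: monom_altdef)
  moreover have "r \<noteq> 0" using r0 by auto
  ultimately show thesis using that by blast
qed

text \<open>The local degree m + 1 at 0 is at most the degree of \<open>p\<close>; if it is
  \<open>d\<close>, only a constant cofactor is left.\<close>

lemma order_wronskian_le:
  assumes "poly p 0 = 0" "poly q 0 \<noteq> 0" "wronskian p q = monom c m" "c \<noteq> 0" "degree p \<le> d"
  shows "Suc m \<le> d" "Suc m = d \<Longrightarrow> \<exists>c'. c' \<noteq> 0 \<and> p = monom c' d"
proof -
  obtain r where r: "p = monom 1 (Suc m) * r" "r \<noteq> 0" using order_wronskian assms(1-4) by blast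
  have deg: "degree p = Suc m + degree r" using r by (simp add: degree_mult_eq degree_monom_eq)
  then show "Suc m \<le> d" using assms(5) by simp
  assume "Suc m = d"
  then have "degree r = 0" using deg assms(5) by simp
  then obtain c' where "r = [:c':]" by (auto elim: degree_eq_zeroE)
  then have "c' \<noteq> 0 \<and> p = monom c' d" using r \<open>Suc m = d\<close> by (simp add: smult_monom)
  then show "\<exists>c'. c' \<noteq> 0 \<and> p = monom c' d" by blast
qed

text \<open>The Wronskian changes chart like a form of degree 2d - 2: the terms that come from
  differentiating z^d cancel.\<close>

lemma poly_wronskian_reversal:
  assumes "degree p \<le> d" "degree q \<le> d" "z \<noteq> 0" "d \<ge> 1"
  shows "poly (wronskian (reversal d p) (reversal d q)) z =
    - (z ^ (2 * d - 2)) * poly (wronskian p q) (inverse z)"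
proof -
  have der: "poly (pderiv (reversal d p)) z =
      of_nat d * z ^ (d - 1) * poly p (inverse z) - z ^ d * poly (pderiv p) (inverse z) / z\<^sup>2"
    if "degree p \<le> d" for p
  proof -
    have "((\<lambda>z. z ^ d * poly p (inverse z)) has_field_derivative
      of_nat d * z ^ (d - 1) * poly p (inverse z) - z ^ d * poly (pderiv p) (inverse z) / z\<^sup>2) (at z)"
      using assms(3) by (auto intro!: derivative_eq_intros DERIV_chain2[OF poly_DERIV]
        simp: field_simps power2_eq_square)
    then have "(poly (reversal d p) has_field_derivative
      of_nat d * z ^ (d - 1) * poly p (inverse z) - z ^ d * poly (pderiv p) (inverse z) / z\<^sup>2) (at z)"
      by (rule has_field_derivative_transform_within_open[of _ _ _ "- {0}"])
        (use assms(3) that in \<open>auto simp: poly_reversal\<close>)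
    then show ?thesis using poly_DERIV DERIV_unique by blast
  qed
  obtain n where n: "d = Suc n" using assms(4) by (metis not0_implies_Suc not_one_le_zero)
  define u where "u = z ^ n"
  have u: "z ^ d = z * u" "z ^ (d - 1) = u" "z ^ (2 * d - 2) = u * u"
    by (simp_all add: n u_def mult_2 power_add)
  show ?thesis
    unfolding wronskian_def poly_diff poly_mult der[OF assms(1)] der[OF assms(2)]
      poly_reversal[OF assms(1,3)] poly_reversal[OF assms(2,3)] u
    using assms(3) by (simp add: power2_eq_square divide_simps) (simp add: algebra_simps)
qed

lemma wronskian_combine: "wronskian (p - smult y q) q = wronskian p q"
  by (simp add: wronskian_def pderiv_diff pderiv_smult algebra_simps)

text \<open>Riemann-Hurwitz: the Wronskian vanishes only at 0 and infinity, to orders m and m' with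
  m + m' = 2d - 2. Both are at most d - 1, so both equal d - 1, and the map is totally ramified at 0
  and infinity.\<close>

lemma rat_fun_two_critical_points:
  assumes "d \<ge> 2" "rat_rep d p q"
    and crit: "\<And>x. critical_point (rat_fun d p q) x \<longleftrightarrow> x = Some 0 \<or> x = None"
    and 0: "rat_fun d p q (Some 0) = Some 0" and inf: "rat_fun d p q None \<noteq> None"
  obtains M where "moebius M" "rat_fun d p q = M \<circ> sphere_pow d"
proof -
  let ?P = "reversal d p" and ?Q = "reversal d q"
  have deg: "degree p \<le> d" "degree q \<le> d" using assms(2) by (auto simp: rat_rep_def)
  have p0: "poly p 0 = 0" "poly q 0 \<noteq> 0" using 0 by (auto simp: pt_def split: if_splits)
  have qd: "coeff q d \<noteq> 0" using inf by (auto simp: pt_def split: if_splits)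
  define y where "y = coeff p d / coeff q d"
  obtain c m where W: "c \<noteq> 0" "wronskian p q = monom c m"
    using poly_only_root_0[of "wronskian p q"] wronskian_nonzero[OF assms(2)] crit by auto
  have WR: "poly (wronskian ?P ?Q) z = - (z ^ (2 * d - 2)) * (c * inverse z ^ m)" if "z \<noteq> 0" for z
    using poly_wronskian_reversal[OF deg that] assms(1) W(2) by (simp add: poly_monom)
  obtain c' m' where W': "c' \<noteq> 0" "wronskian ?P ?Q = monom c' m'"
    using poly_only_root_0[of "wronskian ?P ?Q"] WR W(1) by auto
  have *: "c' * z ^ (m + m') = - c * z ^ (2 * d - 2)" if "z \<noteq> 0" for z
    using WR[OF that] that by (simp add: W' poly_monom power_add field_simps)
  \<comment> \<open>The identity is known away from 0 only. The positive integers up to m + m' + 2d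
    + 1 are more points than either degree.\<close>
  have "monom c' (m + m') = monom (- c) (2 * d - 2)"
  proof (rule poly_eqI_degree[of "(\<lambda>n. of_nat (Suc n)) ` {..m + m' + 2 * d}"], goal_cases)
    case (1 z)
    then show ?case using * by (auto simp: poly_monom simp del: of_nat_Suc)
  next
    case 2
    then show ?case by (simp add: card_image inj_on_def degree_monom_eq W')
  next
    case 3
    then show ?case by (simp add: card_image inj_on_def degree_monom_eq W)
  qed
  then have mm: "m + m' = 2 * d - 2"
    using W(1) W'(1) by (metis degree_monom_eq neg_equal_0_iff_equal)
  \<comment> \<open>As \<open>y\<close> is the value at infinity, this makes the numerator vanish
    there, and the order bound applies in that chart too.\<close>
  let ?R = "?P - smult y ?Q"
  have R: "poly ?R 0 = 0" "poly ?Q 0 \<noteq> 0" "wronskian ?R ?Q = monom c' m'" "degree ?R \<le> d"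
    using qd W'(2) deg by (auto simp: poly_reversal_0 y_def wronskian_combine degree_reversal
      intro!: degree_diff_le order_trans[OF degree_smult_le])
  have "Suc m \<le> d" "Suc m' \<le> d"
    using order_wronskian_le(1)[OF p0 W(2,1) deg(1)] order_wronskian_le(1)[OF R(1-3) W'(1) R(4)] by auto
  then have "Suc m = d" "Suc m' = d" using mm assms(1) by auto
  then obtain a b where a: "a \<noteq> 0" "p = monom a d" and b: "b \<noteq> 0" "?R = monom b d"
    using order_wronskian_le(2)[OF p0 W(2,1) deg(1)] order_wronskian_le(2)[OF R(1-3) W'(1) R(4)] by auto
  have pq: "p - smult y q = [:b:]"
  proof (rule poly_eqI)
    fix n
    show "coeff (p - smult y q) n = coeff [:b:] n"
    proof (cases "n \<le> d")
      case True
      then have "coeff ?R (d - n) = coeff (p - smult y q) n"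
        by (simp add: coeff_reversal deg)
      moreover have "coeff ?R (d - n) = coeff [:b:] n"
        unfolding b(2) using True assms(1) by (cases n) auto
      ultimately show ?thesis by simp
    next
      case False
      then show ?thesis using deg by (auto simp: coeff_eq_0 coeff_pCons split: nat.splits)
    qed
  qed
  have "y \<noteq> 0"
  proof
    assume "y = 0"
    then have "poly p 0 = b" using pq by simp
    then show False using p0 b by simp
  qed
  have yq: "smult y q = monom a d - [:b:]" using pq a by (metis diff_diff_eq2 add_diff_cancel_left')
  \<comment> \<open>From p = a z^d and y q = a z^d - b, the map is y a z^d / (a z^d - b).\<close>
  let ?M = "moebius_map (y * a) 0 a (- b)"
  have "rat_fun d p q w = (?M \<circ> sphere_pow d) w" for w
  proof (cases w)
    case None
    have "y * coeff q d = a" using yq assms(1) by (metis One_nat_def Suc_1 a(2) qd y_def nonzero_eq_divide_eq coeff_monom)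
    moreover have "coeff p d = a" using a by simp
    ultimately show ?thesis
      using None \<open>y \<noteq> 0\<close> pt_scale[of y a "coeff q d"] by (simp add: moebius_map_def)
  next
    case (Some z)
    have "poly (smult y q) z = poly (monom a d - [:b:]) z" using yq by simp
    then have "y * poly q z = a * z ^ d - b" by (simp add: poly_monom)
    moreover have "poly p z = a * z ^ d" using a by (simp add: poly_monom)
    ultimately show ?thesis
      using Some \<open>y \<noteq> 0\<close> pt_scale[of y "a * z ^ d" "poly q z"]
      by (simp add: moebius_map_def mult.assoc)
  qed
  moreover have "moebius ?M" using \<open>y \<noteq> 0\<close> a b by (intro moebiusI) simp
  ultimately show thesis using that by blast
qed

lemma critical_point_moebius_comp:
  assumes "moebius T"
  shows "critical_point (T \<circ> G) x \<longleftrightarrow> critical_point G x"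
proof -
  have "inj_on (T \<circ> G) U \<longleftrightarrow> inj_on G U" for U
    using moebius_inv_simps(3)[OF assms] by (auto simp: inj_on_def)
  then show ?thesis by (simp add: critical_point_iff)
qed

lemma critical_point_comp_moebius:
  assumes "moebius T"
  shows "critical_point (G \<circ> T) x \<longleftrightarrow> critical_point G (T x)"
  using critical_point_comp[of T G x] moebius_sphere_cont moebius_sphere_open
    moebius_not_critical assms by blast

text \<open>Moebius coordinates put the critical points at 0 and infinity and the first critical
  value at 0, where the count above applies.\<close>

lemma bicritical_normal_form:
  assumes "bicritical f"
  obtains d A B where "d \<ge> 2" "moebius A" "moebius B" "f = A \<circ> sphere_pow d \<circ> B"
proof -
  obtain d where d: "d \<ge> 2" "rational_map_deg d f" and "card (crit_points f) = 2"
    using assms unfolding bicritical_def by blast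
  then obtain c1 c2 where c: "c1 \<noteq> c2" "\<And>x. critical_point f x \<longleftrightarrow> x = c1 \<or> x = c2"
    unfolding card_2_iff crit_points_def by blast
  obtain p q where pq: "rat_rep d p q" "f = rat_fun d p q"
    using rational_map_deg_rat_fun d by (metis One_nat_def Suc_1 Suc_leD)
  obtain B where B: "moebius B" "B c1 = Some 0" "B c2 = None" using moebius_exists2 c(1) by metis
  \<comment> \<open>The critical values are not yet known to differ. Sending a third point to
    infinity keeps both of them finite.\<close>
  obtain r where r: "r \<noteq> f c1" "r \<noteq> f c2" using exists_third by metis
  obtain S where S: "moebius S" "S (f c1) = Some 0" "S r = None" using moebius_exists2 r(1) by metis
  note iB = moebius_inv_simps[OF B(1)] and iS = moebius_inv_simps[OF S(1)]
  obtain p' q' where 1: "rat_rep d p' q'" "f \<circ> inv B = rat_fun d p' q'"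
    using rat_fun_comp_moebius moebius_inverse(2)[OF B(1)] pq by metis
  obtain p'' q'' where 2: "rat_rep d p'' q''" "S \<circ> (f \<circ> inv B) = rat_fun d p'' q''"
    using rat_fun_moebius[OF S(1) 1(1)] 1(2) by metis
  have b: "inv B (Some 0) = c1" "inv B None = c2" using B(2,3) iB by metis+
  have "critical_point (rat_fun d p'' q'') x \<longleftrightarrow> x = Some 0 \<or> x = None" for x
  proof -
    have "critical_point (rat_fun d p'' q'') x \<longleftrightarrow> inv B x = c1 \<or> inv B x = c2"
      unfolding 2(2)[symmetric] critical_point_moebius_comp[OF S(1)]
      using critical_point_comp_moebius moebius_inverse(2)[OF B(1)] c(2) by blast
    also have "\<dots> \<longleftrightarrow> x = Some 0 \<or> x = None" using b iB by metis
    finally show ?thesis .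
  qed
  moreover have "rat_fun d p'' q'' (Some 0) = Some 0" "rat_fun d p'' q'' None \<noteq> None"
    unfolding 2(2)[symmetric] using b S iS r by (simp, metis comp_apply)
  ultimately obtain M where M: "moebius M" "rat_fun d p'' q'' = M \<circ> sphere_pow d"
    using rat_fun_two_critical_points[OF d(1) 2(1)] by blast
  have "f x = inv S (M (sphere_pow d (B x)))" for x
  proof -
    have "S (f (inv B (B x))) = M (sphere_pow d (B x))"
      using 2(2) M(2) by (metis comp_apply)
    then show ?thesis using iS iB by metis
  qed
  then have "f = (inv S \<circ> M) \<circ> sphere_pow d \<circ> B" by (simp add: fun_eq_iff)
  then show thesis
    using that d(1) B(1) moebius_comp[OF moebius_inverse(2)[OF S(1)] M(1)] by blast
qed

section \<open>Bicritical maps in normal form\<close>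

text \<open>The set Z of the outline. It depends on the map alone, so equal iterates have equal
  sets.\<close>

definition totally_critical :: "(sphere \<Rightarrow> sphere) \<Rightarrow> sphere set" where
  "totally_critical G = {y. \<forall>x. G x = y \<longrightarrow> critical_point G x}"

text \<open>\<mu> carries the fibre over y onto the fibre over \<nu> y and preserves critical
  points.\<close>

lemma totally_critical_symmetric:
  assumes "moebius \<mu>" "moebius \<nu>" "G \<circ> \<mu> = \<nu> \<circ> G"
  shows "\<nu> ` totally_critical G = totally_critical G"
proof -
  note i\<mu> = moebius_inv_simps[OF assms(1)] and i\<nu> = moebius_inv_simps[OF assms(2)]
  have eq: "G (\<mu> x) = \<nu> (G x)" for x using assms(3) by (metis comp_apply)
  have crit: "critical_point G (\<mu> x) \<longleftrightarrow> critical_point G x" for x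
    using critical_point_comp_moebius[OF assms(1), of G x]
      critical_point_moebius_comp[OF assms(2), of G x] assms(3) by simp
  have iff: "\<nu> y \<in> totally_critical G \<longleftrightarrow> y \<in> totally_critical G" for y
    unfolding totally_critical_def mem_Collect_eq by (metis crit eq i\<mu>(2) i\<nu>(3))
  show ?thesis
  proof
    show "\<nu> ` totally_critical G \<subseteq> totally_critical G" using iff by blast
    show "totally_critical G \<subseteq> \<nu> ` totally_critical G" using iff i\<nu>(2) by (metis image_eqI subsetI)
  qed
qed

locale normal_form =
  fixes f :: "sphere \<Rightarrow> sphere" and d :: nat and A B :: "sphere \<Rightarrow> sphere"
  assumes d_ge_2: "d \<ge> 2" and A: "moebius A" and B: "moebius B"
    and f_eq: "f = A \<circ> sphere_pow d \<circ> B"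
begin

lemmas inv_A = moebius_inv_simps[OF A] and inv_B = moebius_inv_simps[OF B]

definition "c1 = inv B (Some 0)"
definition "c2 = inv B None"
definition "v1 = A (Some 0)"
definition "v2 = A None"

lemma B_eq: "B x = Some 0 \<longleftrightarrow> x = c1" "B x = None \<longleftrightarrow> x = c2"
  unfolding c1_def c2_def using inv_B by metis+

lemma c_distinct: "c1 \<noteq> c2" and v_distinct: "v1 \<noteq> v2"
  unfolding c1_def c2_def v1_def v2_def using inv_A inv_B by (metis option.distinct(1))+

lemma f_apply: "f x = A (sphere_pow d (B x))"
  by (simp add: f_eq)

lemma f_eq_v: "f x = v1 \<longleftrightarrow> x = c1" "f x = v2 \<longleftrightarrow> x = c2"
proof -
  have "sphere_pow d w = Some 0 \<longleftrightarrow> w = Some 0" "sphere_pow d w = None \<longleftrightarrow> w = None" for w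
    using d_ge_2 by (cases w; simp)+
  then show "f x = v1 \<longleftrightarrow> x = c1" "f x = v2 \<longleftrightarrow> x = c2"
    by (simp_all add: f_apply v1_def v2_def inv_A B_eq)
qed

lemma f_c [simp]: "f c1 = v1" "f c2 = v2"
  using f_eq_v by blast+

lemma f_in_V: "f x \<in> {v1, v2} \<longleftrightarrow> x \<in> {c1, c2}"
  using f_eq_v by blast

lemma cont: "sphere_cont f" and opn: "sphere_open f"
  unfolding f_eq using d_ge_2
  by (intro sphere_cont_comp sphere_open_comp moebius_sphere_cont[OF A] moebius_sphere_cont[OF B]
    moebius_sphere_open[OF A] moebius_sphere_open[OF B] sphere_pow_cont sphere_pow_open; simp)+

lemma cont_iterate: "sphere_cont (f ^^ j)" and opn_iterate: "sphere_open (f ^^ j)"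
proof (induction j)
  case 0
  show "sphere_cont (f ^^ 0)" "sphere_open (f ^^ 0)"
    using moebius_sphere_cont moebius_sphere_open moebius_id by auto
next
  case (Suc j)
  then show "sphere_cont (f ^^ Suc j)" "sphere_open (f ^^ Suc j)"
    using cont opn sphere_cont_comp sphere_open_comp by auto
qed

lemma critical_iff: "critical_point f x \<longleftrightarrow> x \<in> {c1, c2}"
proof -
  have "critical_point f x \<longleftrightarrow> critical_point (sphere_pow d) (B x)"
    unfolding f_eq comp_assoc critical_point_moebius_comp[OF A]
    by (rule critical_point_comp_moebius[OF B])
  then show ?thesis using critical_point_sphere_pow[OF d_ge_2] B_eq by auto
qed

lemma crit_points_eq: "crit_points f = {c1, c2}"
  using critical_iff by (auto simp: crit_points_def)

lemma crit_values_eq: "crit_values f = {v1, v2}"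
  by (simp add: crit_values_def crit_points_eq)

lemma rational_comp:
  assumes "rational_fun G"
  shows "rational_fun (f \<circ> G)"
proof -
  have "f \<circ> G = A \<circ> (sphere_pow d \<circ> (B \<circ> G))" by (simp add: f_eq comp_assoc)
  then show ?thesis
    using assms d_ge_2 rational_fun_moebius_comp rational_fun_pow_comp A B by simp
qed

lemma rational_iterate_comp: "rational_fun G \<Longrightarrow> rational_fun (f ^^ j \<circ> G)"
  by (induction j) (auto simp: comp_assoc rational_comp)

lemma surj_f: "\<exists>x. f x = y"
proof -
  obtain w where "sphere_pow d w = inv A y"
  proof (cases "inv A y")
    case None
    then show ?thesis using that[of None] by simp
  next
    case (Some z)
    moreover obtain u where "u ^ d = z" using complex_root_exists[of d z] d_ge_2 by auto
    ultimately show ?thesis using that[of "Some u"] by simp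
  qed
  then have "f (inv B w) = y" by (simp add: f_apply inv_A inv_B)
  then show ?thesis by blast
qed

section \<open>Deck transformations of \<open>f\<close>\<close>

definition "deck \<omega> = inv B \<circ> scale \<omega> \<circ> B"

lemma moebius_scale: "\<omega> \<noteq> 0 \<Longrightarrow> moebius (scale \<omega>)"
  by (intro moebiusI) simp

lemma scale_simps [simp]: "scale \<omega> (Some z) = Some (\<omega> * z)" "\<omega> \<noteq> 0 \<Longrightarrow> scale \<omega> None = None"
  by (simp_all add: moebius_map_def pt_def)

lemma root_nonzero: "\<omega> ^ d = 1 \<Longrightarrow> \<omega> \<noteq> 0" for \<omega> :: complex
  using d_ge_2 by (auto simp: zero_power)

lemma moebius_deck: "\<omega> ^ d = 1 \<Longrightarrow> moebius (deck \<omega>)"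
  unfolding deck_def by (intro moebius_comp moebius_inverse moebius_scale root_nonzero B)

lemma f_deck: "\<omega> ^ d = 1 \<Longrightarrow> f (deck \<omega> x) = f x"
  using root_nonzero[of \<omega>]
  by (cases "B x") (auto simp: f_apply deck_def inv_B power_mult_distrib)

lemma deck_1: "deck 1 = id"
  using moebius_map_scalar[of 1] inv_B by (auto simp: deck_def)

lemma deck_fix:
  assumes "\<omega> ^ d = 1" "\<omega> \<noteq> 1"
  shows "deck \<omega> x = x \<longleftrightarrow> x \<in> {c1, c2}"
proof -
  have "deck \<omega> x = x \<longleftrightarrow> scale \<omega> (B x) = B x"
    unfolding deck_def comp_apply by (metis inv_B(1,2))
  also have "\<dots> \<longleftrightarrow> B x = Some 0 \<or> B x = None"
    using assms(2) root_nonzero[OF assms(1)] by (cases "B x") auto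
  finally show ?thesis by (simp add: B_eq)
qed

lemma deck_deck: "\<omega> ^ d = 1 \<Longrightarrow> \<eta> ^ d = 1 \<Longrightarrow> deck \<omega> (deck \<eta> x) = deck (\<omega> * \<eta>) x"
  using root_nonzero[of \<omega>] root_nonzero[of \<eta>] by (cases "B x") (auto simp: deck_def inv_B mult.assoc)

text \<open>Fixing one nontrivial root gives a single map \<rho> whose fixed points are the critical
  points; its square is the identity only for d = 2.\<close>

definition "\<zeta> = (SOME z::complex. z ^ d = 1 \<and> z \<noteq> 1 \<and> (d \<ge> 3 \<longrightarrow> z\<^sup>2 \<noteq> 1))"

lemma \<zeta>: "\<zeta> ^ d = 1" "\<zeta> \<noteq> 1" "d \<ge> 3 \<Longrightarrow> \<zeta>\<^sup>2 \<noteq> 1"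
proof -
  have "\<exists>z::complex. z ^ d = 1 \<and> z \<noteq> 1 \<and> (d \<ge> 3 \<longrightarrow> z\<^sup>2 \<noteq> 1)"
    using primitive_root[OF d_ge_2] by metis
  from someI_ex[OF this] show "\<zeta> ^ d = 1" "\<zeta> \<noteq> 1" "d \<ge> 3 \<Longrightarrow> \<zeta>\<^sup>2 \<noteq> 1"
    unfolding \<zeta>_def by blast+
qed

definition "\<rho> = deck \<zeta>"

lemma moebius_\<rho>: "moebius \<rho>"
  unfolding \<rho>_def by (rule moebius_deck[OF \<zeta>(1)])

lemma f_\<rho> [simp]: "f (\<rho> x) = f x"
  unfolding \<rho>_def by (rule f_deck[OF \<zeta>(1)])

lemma \<rho>_fix: "\<rho> x = x \<longleftrightarrow> x \<in> {c1, c2}"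
  unfolding \<rho>_def by (rule deck_fix[OF \<zeta>(1,2)])

lemma \<rho>_\<rho>_fix: "d \<ge> 3 \<Longrightarrow> \<rho> (\<rho> x) = x \<longleftrightarrow> x \<in> {c1, c2}"
  unfolding \<rho>_def using deck_deck[OF \<zeta>(1) \<zeta>(1)] deck_fix[of "\<zeta> * \<zeta>"] \<zeta>
  by (simp add: power2_eq_square power_mult_distrib)

lemma deck_quadratic:
  assumes "d = 2" "\<omega> ^ d = 1"
  shows "deck \<omega> = id \<or> deck \<omega> = \<rho>"
proof -
  have "\<omega> = 1 \<or> \<omega> = -1" "\<zeta> = 1 \<or> \<zeta> = -1" using assms \<zeta>(1) by (auto simp: power2_eq_1_iff)
  then show ?thesis using \<zeta>(2) deck_1 by (auto simp: \<rho>_def)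
qed

lemma quadratic_fibre:
  assumes "d = 2"
  shows "f x = f y \<longleftrightarrow> y = x \<or> y = \<rho> x"
proof
  assume "f x = f y"
  then have eq: "sphere_pow d (B x) = sphere_pow d (B y)" by (simp add: f_apply inv_A)
  have \<zeta>: "\<zeta> = -1" using assms \<zeta>(1,2) by (auto simp: power2_eq_1_iff)
  have "B y = B x \<or> B y = scale (-1) (B x)"
    using eq unfolding assms by (cases "B x"; cases "B y") (auto simp: power2_eq_iff)
  then have "B y = B x \<or> B y = scale \<zeta> (B x)" unfolding \<zeta> .
  then show "y = x \<or> y = \<rho> x"
    unfolding \<rho>_def deck_def comp_apply using inv_B by metis
qed auto

text \<open>At each point the two maps differ by one of finitely many rotations. Some rotation
  therefore serves infinitely many points, and by the identity theorem all points.\<close>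

lemma cancel:
  assumes "rational_fun G" "rational_fun H" "f \<circ> G = f \<circ> H"
  obtains \<omega> where "\<omega> ^ d = 1" "G = deck \<omega> \<circ> H"
proof -
  let ?E = "\<lambda>\<omega>. {w. B (G w) = scale \<omega> (B (H w))}"
  have "\<exists>\<omega>. \<omega> ^ d = 1 \<and> B (G w) = scale \<omega> (B (H w))" for w
  proof -
    have eq: "sphere_pow d (B (G w)) = sphere_pow d (B (H w))"
      using fun_cong[OF assms(3), of w] by (simp add: f_apply inv_A)
    show ?thesis
    proof (cases "B (H w) = None \<or> B (H w) = Some 0")
      case True
      then have "B (G w) = scale 1 (B (H w))"
        using eq d_ge_2 by (cases "B (G w)") (auto simp: zero_power)
      then show ?thesis by (intro exI[of _ 1]) simp
    next
      case False
      then obtain u v where uv: "B (G w) = Some u" "B (H w) = Some v" "v \<noteq> 0"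
        using eq by (cases "B (G w)"; cases "B (H w)") auto
      then show ?thesis using eq by (intro exI[of _ "u / v"]) (simp add: power_divide)
    qed
  qed
  then have "UNIV = (\<Union>\<omega>\<in>{\<omega>. \<omega> ^ d = 1}. ?E \<omega>)" by blast
  moreover have "finite {\<omega>::complex. \<omega> ^ d = 1}"
    using d_ge_2 by (intro finite_roots_unity) simp
  ultimately have "\<exists>\<omega>\<in>{\<omega>. \<omega> ^ d = 1}. infinite (?E \<omega>)"
    using infinite_sphere finite_UN_I[of "{\<omega>. \<omega> ^ d = 1}" ?E] by metis
  then obtain \<omega> where \<omega>: "\<omega> ^ d = 1" "infinite (?E \<omega>)" by blast
  have "B \<circ> G = scale \<omega> \<circ> (B \<circ> H)"
    using \<omega> assms(1,2) B moebius_scale root_nonzero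
    by (intro rational_fun_eqI rational_fun_moebius_comp) auto
  then have "B (G w) = scale \<omega> (B (H w))" for w by (metis comp_apply)
  then have "G w = inv B (scale \<omega> (B (H w)))" for w using inv_B by metis
  then have "G = deck \<omega> \<circ> H" by (auto simp: deck_def)
  then show thesis using that \<omega>(1) by blast
qed

text \<open>In the coordinate of \<open>A\<close> the map is z -> a z or z -> a / z, as it fixes or
  exchanges 0 and infinity. With b^d = a, the lift is z -> b z or z -> b / z.\<close>

lemma lift:
  assumes "moebius \<nu>" "\<nu> ` {v1, v2} = {v1, v2}"
  obtains \<nu>' where "moebius \<nu>'" "f \<circ> \<nu>' = \<nu> \<circ> f"
proof -
  note result = that
  let ?N = "inv A \<circ> \<nu> \<circ> A"
  have N: "moebius ?N" by (intro moebius_comp moebius_inverse assms A)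
  have lifted: thesis
    if T: "moebius T" "sphere_pow d \<circ> T = ?N \<circ> sphere_pow d" for T
  proof -
    have "sphere_pow d (T w) = inv A (\<nu> (A (sphere_pow d w)))" for w
      using fun_cong[OF T(2), of w] by simp
    then have "f \<circ> (inv B \<circ> T \<circ> B) = \<nu> \<circ> f"
      by (auto simp: f_apply inv_A inv_B)
    moreover have "moebius (inv B \<circ> T \<circ> B)"
      by (intro moebius_comp moebius_inverse T B)
    ultimately show thesis using result by blast
  qed
  have "\<nu> v1 = v1 \<and> \<nu> v2 = v2 \<or> \<nu> v1 = v2 \<and> \<nu> v2 = v1"
    using assms(2) v_distinct by (auto simp: doubleton_eq_iff)
  then consider "?N (Some 0) = Some 0" "?N None = None" | "?N (Some 0) = None" "?N None = Some 0"
    by (auto simp: v1_def v2_def inv_A)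
  then show thesis
  proof cases
    case 1
    then obtain a where a: "a \<noteq> 0" "?N = scale a" using moebius_fix_0_inf[OF N] by blast
    obtain b where b: "b ^ d = a" using complex_root_exists[of d a] d_ge_2 by auto
    then have "b \<noteq> 0" using a d_ge_2 by (auto simp: zero_power)
    have "(sphere_pow d \<circ> scale b) w = (?N \<circ> sphere_pow d) w" for w
      unfolding a(2) using b a(1) \<open>b \<noteq> 0\<close> by (cases w) (auto simp: power_mult_distrib)
    then show thesis using lifted[OF moebius_scale[OF \<open>b \<noteq> 0\<close>]] by blast
  next
    case 2
    then obtain a where a: "a \<noteq> 0" "?N = flip a" using moebius_flip_0_inf[OF N] by blast
    obtain b where b: "b ^ d = a" using complex_root_exists[of d a] d_ge_2 by auto
    then have "b \<noteq> 0" using a d_ge_2 by (auto simp: zero_power)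
    have "(sphere_pow d \<circ> flip b) w = (?N \<circ> sphere_pow d) w" for w
      unfolding a(2) using b a(1) \<open>b \<noteq> 0\<close> d_ge_2
      by (cases w) (auto simp: moebius_map_def pt_def power_divide)
    moreover have "moebius (flip b)" using \<open>b \<noteq> 0\<close> by (intro moebiusI) simp
    ultimately show thesis using lifted by blast
  qed
qed

text \<open>One step down the chain of iterates. A lift of \<nu> fits only up to a deck
  transformation, which \<open>cancel\<close> supplies. The result preserves the critical points,
  these being the preimages of the critical values.\<close>

lemma descend:
  assumes "moebius \<mu>" "moebius \<nu>" "f ^^ Suc j \<circ> \<mu> = \<nu> \<circ> f ^^ Suc j" "\<nu> ` {v1, v2} = {v1, v2}"
  obtains \<nu>' where "moebius \<nu>'" "f ^^ j \<circ> \<mu> = \<nu>' \<circ> f ^^ j" "f \<circ> \<nu>' = \<nu> \<circ> f"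
    "\<nu>' ` {c1, c2} = {c1, c2}"
proof -
  obtain \<nu>0 where \<nu>0: "moebius \<nu>0" "f \<circ> \<nu>0 = \<nu> \<circ> f" using lift assms by blast
  have "f \<circ> (f ^^ j \<circ> \<mu>) = \<nu> \<circ> f \<circ> f ^^ j" using assms(3) by (simp add: comp_assoc)
  also have "\<dots> = f \<circ> (\<nu>0 \<circ> f ^^ j)" using \<nu>0(2) by (metis comp_assoc)
  finally have eq: "f \<circ> (f ^^ j \<circ> \<mu>) = f \<circ> (\<nu>0 \<circ> f ^^ j)" .
  have "rational_fun (f ^^ j \<circ> \<mu>)" "rational_fun (\<nu>0 \<circ> f ^^ j)"
    using rational_iterate_comp moebius_rational_fun assms(1) rational_fun_moebius_comp \<nu>0(1)
      rational_iterate_comp[OF rational_fun_id] by auto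
  then obtain \<omega> where \<omega>: "\<omega> ^ d = 1" "f ^^ j \<circ> \<mu> = deck \<omega> \<circ> (\<nu>0 \<circ> f ^^ j)"
    using cancel eq by blast
  let ?N = "deck \<omega> \<circ> \<nu>0"
  have N: "moebius ?N" using moebius_comp moebius_deck \<omega>(1) \<nu>0(1) by blast
  have f: "f \<circ> ?N = \<nu> \<circ> f" using \<nu>0(2) f_deck[OF \<omega>(1)] by (auto simp: fun_eq_iff)
  then have "f (?N x) = \<nu> (f x)" for x by (metis comp_apply)
  then have "?N c1 \<in> {c1, c2}" "?N c2 \<in> {c1, c2}" "?N c1 \<noteq> ?N c2"
    using assms(4) f_in_V f_c c_distinct moebius_inv_simps(3)[OF N] by (metis image_eqI insertI1 insertI2)+
  then have "?N ` {c1, c2} = {c1, c2}" by auto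
  then show thesis using that N f \<omega>(2) by (simp add: comp_assoc)
qed

section \<open>Totally critical points of iterates\<close>

definition "W = {y. y \<notin> {v1, v2} \<and> f -` {y} \<subseteq> {v1, v2}}"

lemma fibre_two:
  assumes "y \<notin> {v1, v2}"
  obtains x where "x \<notin> {c1, c2}" "f x = y" "\<rho> x \<noteq> x"
  using surj_f[of y] assms f_in_V \<rho>_fix by metis

text \<open>This identifies the points of \<open>W\<close> with the point w of the outline. A point
  x over w is not critical, so x and \<rho> x are distinct and must be the two critical values; for
  d \<ge> 3 applying \<rho> again would give a third point.\<close>

lemma W_fibre:
  assumes "w \<in> W"
  shows "f -` {w} = {v1, v2}" "f v1 = w" "f v2 = w" "d = 2" "w \<notin> {v1, v2}"
proof -
  show w: "w \<notin> {v1, v2}" using assms W_def by blast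
  then obtain x where x: "x \<notin> {c1, c2}" "f x = w" "\<rho> x \<noteq> x" by (rule fibre_two)
  have sub: "y \<in> {v1, v2}" if "f y = w" for y using assms that by (auto simp: W_def)
  then have "x \<in> {v1, v2}" "\<rho> x \<in> {v1, v2}" using x by auto
  then have "{v1, v2} = {x, \<rho> x}" using x(3) by auto
  then show "f v1 = w" "f v2 = w" using x(2) by (metis f_\<rho> insertI1 insertI2 insertE singletonD)+
  then show "f -` {w} = {v1, v2}" using sub by auto
  show "d = 2"
  proof (rule ccontr)
    assume "d \<noteq> 2"
    then have "\<rho> (\<rho> x) \<noteq> x" using \<rho>_\<rho>_fix x(1) d_ge_2 by auto
    moreover have "\<rho> (\<rho> x) \<noteq> \<rho> x" using x(3) moebius_inv_simps(3)[OF moebius_\<rho>] by simp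
    moreover have "\<rho> (\<rho> x) \<in> {v1, v2}" using x(2) sub by simp
    ultimately show False using \<open>{v1, v2} = {x, \<rho> x}\<close> by auto
  qed
qed

text \<open>The critical points of f^(j+1) are those of f^j and the points that f^j sends to
  critical points of f. Over a non-critical value of f only the former occur.\<close>

lemma totally_critical_Suc:
  "totally_critical (f ^^ Suc j) = {v1, v2} \<union> {y. f -` {y} \<subseteq> totally_critical (f ^^ j)}"
proof -
  have crit: "critical_point (f ^^ Suc j) x \<longleftrightarrow> critical_point (f ^^ j) x \<or> f ((f ^^ j) x) \<in> {v1, v2}" for x
    using critical_point_comp[OF cont_iterate opn_iterate, of f j] critical_iff f_in_V by simp
  have "y \<in> totally_critical (f ^^ Suc j) \<longleftrightarrow> y \<in> {v1, v2} \<or> (\<forall>z. f z = y \<longrightarrow> z \<in> totally_critical (f ^^ j))" for y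
  proof (cases "y \<in> {v1, v2}")
    case True
    then show ?thesis unfolding totally_critical_def mem_Collect_eq crit by simp
  next
    case False
    then show ?thesis unfolding totally_critical_def mem_Collect_eq crit by simp blast
  qed
  then show ?thesis by (simp add: set_eq_iff subset_iff)
qed

text \<open>Nothing beyond \<open>W\<close> can arise: the fibre of a further point would lie in
  \<open>W\<close>, which has at most one element, while that fibre has at least two.\<close>

lemma totally_critical_iterate:
  "totally_critical (f ^^ Suc j) \<subseteq> {v1, v2} \<union> W" "{v1, v2} \<subseteq> totally_critical (f ^^ Suc j)"
proof -
  show V: "{v1, v2} \<subseteq> totally_critical (f ^^ Suc j)" for j
    unfolding totally_critical_Suc by blast
  show "totally_critical (f ^^ Suc j) \<subseteq> {v1, v2} \<union> W"
  proof (induction j)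
    case 0
    have "totally_critical (f ^^ 0) = {}"
      using not_critical_if_inj[of id] by (auto simp: totally_critical_def)
    then show ?case using surj_f unfolding totally_critical_Suc by auto
  next
    case (Suc j)
    have "y \<in> {v1, v2} \<union> W" if y: "f -` {y} \<subseteq> {v1, v2} \<union> W" for y
    proof (rule ccontr)
      assume n: "y \<notin> {v1, v2} \<union> W"
      then obtain w where w: "w \<in> W" "f w = y" using y by (auto simp: W_def)
      obtain x where x: "f x = y" "\<rho> x \<noteq> x" using fibre_two n by (metis UnI1)
      have "f x' \<noteq> y" if "x' \<in> {v1, v2}" for x' using W_fibre(2,3)[OF w(1)] w(1) n that by auto
      then have "z \<in> W" if "f z = y" for z using y that by blast
      then have "x \<in> W" "\<rho> x \<in> W" using x by auto
      then show False using W_fibre(2) x(2) by metis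
    qed
    moreover have "f -` {y} \<subseteq> {v1, v2} \<union> W" if "f -` {y} \<subseteq> totally_critical (f ^^ Suc j)" for y
      using that Suc by (rule subset_trans)
    ultimately show ?case unfolding totally_critical_Suc[of "Suc j"] by blast
  qed
qed

text \<open>Points of \<open>W\<close> enter at the second iterate, since their fibres consist of
  critical values, which are totally critical from the first iterate on.\<close>

lemma totally_critical_iterate_ge_2:
  assumes "k \<ge> 2"
  shows "totally_critical (f ^^ k) = {v1, v2} \<union> W"
proof -
  define j where "j = k - 2"
  have j: "k = Suc (Suc j)" using assms by (simp add: j_def)
  have "W \<subseteq> totally_critical (f ^^ k)"
    unfolding j totally_critical_Suc[of "Suc j"] using totally_critical_iterate(2)[of j] by (auto simp: W_def)
  then show ?thesis using totally_critical_iterate[of "Suc j"] j by auto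
qed

end

section \<open>Symmetries of iterates\<close>

context normal_form
begin

section \<open>Symmetries when \<open>W\<close> is empty\<close>

lemma totally_critical_unmixed:
  assumes "W = {}"
  shows "totally_critical (f ^^ Suc j) = {v1, v2}"
  using totally_critical_iterate[of j] assms by auto

lemma symmetry_preserves_V:
  assumes "W = {}" "moebius \<mu>" "moebius \<nu>" "f ^^ Suc j \<circ> \<mu> = \<nu> \<circ> f ^^ Suc j"
  shows "\<nu> ` {v1, v2} = {v1, v2}"
  using totally_critical_symmetric[OF assms(2-4)] unfolding totally_critical_unmixed[OF assms(1)] .

text \<open>Repeated descent ends at f^0, where the map obtained is \<mu> itself.\<close>

lemma symmetry_preserves_C:
  assumes "W = {}" "moebius \<mu>" "moebius \<nu>" "f ^^ Suc j \<circ> \<mu> = \<nu> \<circ> f ^^ Suc j"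
  shows "\<mu> ` {c1, c2} = {c1, c2}"
  using assms(3,4)
proof (induction j arbitrary: \<nu>)
  case (0 \<nu>)
  have "\<nu> ` {v1, v2} = {v1, v2}" by (rule symmetry_preserves_V[OF assms(1,2) 0])
  then obtain \<nu>' where "f ^^ 0 \<circ> \<mu> = \<nu>' \<circ> f ^^ 0" "\<nu>' ` {c1, c2} = {c1, c2}"
    using descend[OF assms(2) 0] by metis
  then show ?case by simp
next
  case (Suc j \<nu>)
  have "\<nu> ` {v1, v2} = {v1, v2}" by (rule symmetry_preserves_V[OF assms(1,2) Suc.prems])
  then obtain \<nu>' where "moebius \<nu>'" "f ^^ Suc j \<circ> \<mu> = \<nu>' \<circ> f ^^ Suc j"
    using descend[OF assms(2) Suc.prems] by metis
  then show ?case by (rule Suc.IH)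
qed

text \<open>In the coordinate of \<open>B\<close> the map is z -> a z; exchanging two points forces
  a^2 = 1, so their squares agree.\<close>

lemma swap_quadratic:
  assumes "d = 2" "moebius \<nu>" "\<nu> c1 = c1" "\<nu> c2 = c2" "\<nu> x = y" "\<nu> y = x" "x \<noteq> y"
  shows "f x = f y"
proof -
  let ?N = "B \<circ> \<nu> \<circ> inv B"
  have "moebius ?N" by (intro moebius_comp moebius_inverse assms B)
  moreover have "?N (Some 0) = Some 0" "?N None = None"
    using assms(3,4) B_eq by (simp_all add: c1_def c2_def)
  ultimately obtain a where a: "a \<noteq> 0" "?N = scale a" by (rule moebius_fix_0_inf)
  have N: "B (\<nu> u) = scale a (B u)" for u using fun_cong[OF a(2), of "B u"] inv_B by simp
  have "x \<noteq> c1" "x \<noteq> c2" using assms by auto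
  then obtain z where z: "B x = Some z" "z \<noteq> 0" using B_eq by (cases "B x") auto
  then have y: "B y = Some (a * z)" using N[of x] assms(5) by simp
  then have "a * (a * z) = z" using N[of y] assms(6) z by simp
  then have "a * a = 1" using z(2) by (metis mult.assoc mult_cancel_right1)
  then have "(a * z)\<^sup>2 = z\<^sup>2" by (simp add: power2_eq_square algebra_simps)
  then show ?thesis using z y assms(1) by (simp add: f_apply)
qed

lemma quadratic_W:
  assumes "d = 2" "f v1 = f v2"
  shows "f v1 \<in> W"
proof -
  have "v2 = \<rho> v1" using quadratic_fibre[OF assms(1)] assms(2) v_distinct by metis
  then have "x \<in> {v1, v2}" if "f x = f v1" for x using quadratic_fibre[OF assms(1), of v1 x] that by auto
  then have "f -` {f v1} \<subseteq> {v1, v2}" by auto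
  moreover have "f v1 \<notin> {v1, v2}" using assms(2) f_eq_v v_distinct by (metis insertE singletonD)
  ultimately show ?thesis by (simp add: W_def)
qed

text \<open>The exchange travels up the chain. By induction \<nu>' exchanges the critical values; if
  it fixed the critical points, f would agree at \<open>v1\<close> and \<open>v2\<close>, and
  \<open>W\<close> would not be empty. So \<nu>' exchanges the critical points, and \<nu> their
  values.\<close>

lemma symmetry_swaps_V:
  assumes "W = {}" "d = 2" "moebius \<mu>" "\<mu> c1 = c2"
    and "moebius \<nu>" "f ^^ Suc j \<circ> \<mu> = \<nu> \<circ> f ^^ Suc j"
  shows "\<nu> v1 = v2"
  using assms(5,6)
proof (induction j arbitrary: \<nu>)
  case (0 \<nu>)
  then have "f (\<mu> c1) = \<nu> (f c1)" by (simp add: fun_eq_iff)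
  then show ?case using assms(4) by simp
next
  case (Suc j \<nu>)
  have "\<nu> ` {v1, v2} = {v1, v2}" by (rule symmetry_preserves_V[OF assms(1,3) Suc.prems])
  then obtain \<nu>' where \<nu>': "moebius \<nu>'" "f ^^ Suc j \<circ> \<mu> = \<nu>' \<circ> f ^^ Suc j"
      "f \<circ> \<nu>' = \<nu> \<circ> f" "\<nu>' ` {c1, c2} = {c1, c2}"
    using descend[OF assms(3) Suc.prems] by metis
  have IH: "\<nu>' v1 = v2" using Suc.IH \<nu>' by blast
  have "\<nu>' ` {v1, v2} = {v1, v2}" by (rule symmetry_preserves_V[OF assms(1,3) \<nu>'(1,2)])
  then have "\<nu>' v2 = v1" using IH v_distinct by (auto simp: doubleton_eq_iff)
  have "\<nu>' c1 \<noteq> c1"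
  proof
    assume "\<nu>' c1 = c1"
    moreover from this have "\<nu>' c2 = c2" using \<nu>'(4) c_distinct by (auto simp: doubleton_eq_iff)
    ultimately have "f v1 = f v2"
      using swap_quadratic[OF assms(2) \<nu>'(1)] IH \<open>\<nu>' v2 = v1\<close> v_distinct by blast
    then show False using quadratic_W assms(1,2) by blast
  qed
  then have "\<nu>' c1 = c2" using \<nu>'(4) by auto
  then show ?case using fun_cong[OF \<nu>'(3), of c1] by simp
qed

section \<open>Deck groups and orbits when \<open>W\<close> is not empty\<close>

lemma quadratic_deck:
  assumes "d = 2" "moebius \<mu>" "f \<circ> \<mu> = f"
  shows "\<mu> = id \<or> \<mu> = \<rho>"
proof -
  obtain \<omega> where "\<omega> ^ d = 1" "\<mu> = deck \<omega> \<circ> id"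
    using cancel[of \<mu> id] moebius_rational_fun rational_fun_id assms by auto
  then show ?thesis using deck_quadratic[OF assms(1)] by simp
qed

text \<open>A Moebius map \<mu>' with f \<mu>' = \<rho> f cannot preserve the totally critical set of an iterate
  of f, as f takes the value \<rho> w \<noteq> w at \<mu>' v1 and \<mu>' v2; hence the deck group stabilises at f^2.\<close>

lemma deck_iterate:
  assumes "w \<in> W" "w \<notin> {c1, c2}" "moebius \<mu>" "f ^^ k \<circ> \<mu> = f ^^ k"
  shows "f ^^ 2 \<circ> \<mu> = f ^^ 2"
  using assms(4)
proof (induction k)
  case 0
  then show ?case by simp
next
  case (Suc j)
  note w = W_fibre[OF assms(1)]
  have id: "f ^^ Suc j \<circ> \<mu> = id \<circ> f ^^ Suc j" "id ` {v1, v2} = {v1, v2}"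
    using Suc.prems by (simp_all only: id_comp image_id id_apply)
  then obtain \<nu> where \<nu>: "moebius \<nu>" "f ^^ j \<circ> \<mu> = \<nu> \<circ> f ^^ j" "f \<circ> \<nu> = id \<circ> f"
    using descend[OF assms(3) moebius_id id] by blast
  then consider "\<nu> = id" | "\<nu> = \<rho>" using quadratic_deck[OF w(4)] by auto
  then show ?case
  proof cases
    case 1
    then show ?thesis using Suc.IH \<nu>(2) by simp
  next
    case 2
    show ?thesis
    \<comment> \<open>For j \<le> 1 the symmetry of f^(j+1) passes to f^2. For larger j one more
      descent reaches f^(j-1), whose exponent is positive, so that the critical values are totally
      critical for it.\<close>
    proof (cases "j \<le> 1")
      case True
      then have "f ^^ 2 = f ^^ (1 - j) \<circ> f ^^ Suc j"
        by (cases j) (auto simp: numeral_2_eq_2)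
      then show ?thesis using Suc.prems by (metis comp_assoc)
    next
      case False
      then obtain i where i: "j = Suc (Suc i)" by (metis One_nat_def le_SucI not0_implies_Suc le0 not_less_eq_eq)
      have "\<rho> v1 = v2" "\<rho> v2 = v1" using quadratic_fibre[OF w(4)] w(2,3) v_distinct by metis+
      then have "\<rho> ` {v1, v2} = {v1, v2}" by auto
      then obtain \<mu>' where \<mu>': "moebius \<mu>'" "f ^^ Suc i \<circ> \<mu> = \<mu>' \<circ> f ^^ Suc i" "f \<circ> \<mu>' = \<rho> \<circ> f"
        using descend[OF assms(3) moebius_\<rho>, of "Suc i"] \<nu>(2) 2 i by metis
      have "\<mu>' v = w" if v: "v \<in> {v1, v2}" for v
      proof -
        have "\<mu>' v \<in> totally_critical (f ^^ Suc i)"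
          using totally_critical_symmetric[OF assms(3) \<mu>'(1,2)] totally_critical_iterate(2)[of i] v by blast
        then have "\<mu>' v \<in> {v1, v2} \<union> W" using totally_critical_iterate(1) by blast
        moreover have "f (\<mu>' v) = \<rho> w" using fun_cong[OF \<mu>'(3), of v] v w(2,3) by auto
        then have "f (\<mu>' v) \<noteq> w" using \<rho>_fix assms(2) by simp
        ultimately show ?thesis using w(2,3) W_fibre(2) by auto
      qed
      then have "\<mu>' v1 = \<mu>' v2" by simp
      then show ?thesis using moebius_inv_simps(3)[OF \<mu>'(1)] v_distinct by blast
    qed
  qed
qed

text \<open>In the coordinate of \<open>S\<close>, f is the square of a Moebius map M that sends 0
  and infinity to the two roots of l, and l and 1 to the two roots of 1. These four values
  overdetermine M.\<close>

lemma cross_ratio_equation: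
  assumes d: "d = 2" and ab: "{v1, v2} = {a, b}"
    and orbit: "f a = w" "f b = w" "f w = p" "f p = p" and "a \<noteq> b" "w \<noteq> p"
    and S: "moebius S" "S a = Some 0" "S b = None" "S p = Some 1" "S w = Some l"
  shows "(l + 1) * (l\<^sup>2 - 6 * l + 1) = 0"
proof -
  note inv_S = moebius_inv_simps[OF S(1)]
  let ?N = "S \<circ> A"
  have N: "moebius ?N" by (intro moebius_comp S A)
  have "v1 = a \<and> v2 = b \<or> v1 = b \<and> v2 = a" using ab by (auto simp: doubleton_eq_iff)
  then consider "?N (Some 0) = Some 0" "?N None = None" | "?N (Some 0) = None" "?N None = Some 0"
    using S(2,3) by (auto simp: v1_def v2_def)
  \<comment> \<open>As \<open>?N\<close> fixes or exchanges 0 and infinity, it can be pulled inside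
    the square.\<close>
  then obtain T where T: "moebius T" "\<And>x. ?N (sphere_pow 2 x) = sphere_pow 2 (T x)"
  proof cases
    case 1
    then obtain c where c: "c \<noteq> 0" "?N = scale c" using moebius_fix_0_inf[OF N] by blast
    obtain e where e: "e\<^sup>2 = c" using complex_root_exists[of 2 c] by auto
    then have "e \<noteq> 0" using c by auto
    have "?N (sphere_pow 2 x) = sphere_pow 2 (scale e x)" for x
      unfolding c(2) using e c(1) \<open>e \<noteq> 0\<close> by (cases x) (auto simp: power_mult_distrib)
    then show thesis using that moebius_scale[OF \<open>e \<noteq> 0\<close>] by blast
  next
    case 2
    then obtain c where c: "c \<noteq> 0" "?N = flip c" using moebius_flip_0_inf[OF N] by blast
    obtain e where e: "e\<^sup>2 = c" using complex_root_exists[of 2 c] by auto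
    then have "e \<noteq> 0" using c by auto
    have "?N (sphere_pow 2 x) = sphere_pow 2 (flip e x)" for x
      unfolding c(2) using e c(1) \<open>e \<noteq> 0\<close>
      by (cases x) (auto simp: moebius_map_def pt_def power_divide)
    moreover have "moebius (flip e)" using \<open>e \<noteq> 0\<close> by (intro moebiusI) simp
    ultimately show thesis using that by blast
  qed
  define M where "M = T \<circ> B \<circ> inv S"
  have M: "moebius M" unfolding M_def by (intro moebius_comp moebius_inverse T B S)
  have f: "S (f x) = sphere_pow 2 (M (S x))" for x
    using T(2) by (simp add: f_apply d M_def inv_S)
  obtain \<alpha> \<beta> \<gamma> \<delta> where ma: "\<alpha> * \<delta> - \<beta> * \<gamma> \<noteq> 0" "M = moebius_map \<alpha> \<beta> \<gamma> \<delta>"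
    using M moebius_def by auto
  have h: "sphere_pow 2 (M (Some 0)) = Some l" "sphere_pow 2 (M None) = Some l"
      "sphere_pow 2 (M (Some l)) = Some 1" "sphere_pow 2 (M (Some 1)) = Some 1"
    using f orbit S by metis+
  have "l \<noteq> 1" using S(4,5) inv_S(3) \<open>w \<noteq> p\<close> by (metis option.inject)
  obtain x0 x1 x2 x3 where x: "M (Some 0) = Some x0" "M None = Some x1"
      "M (Some l) = Some x2" "M (Some 1) = Some x3"
    using h by (metis option.distinct(1) option.exhaust sphere_pow_simps(2))
  have sq: "x0\<^sup>2 = l" "x1\<^sup>2 = l" "x2\<^sup>2 = 1" "x3\<^sup>2 = 1" using h x by simp_all
  have "x0 \<noteq> x1" "x2 \<noteq> x3"
    using x moebius_inv_simps(3)[OF M] \<open>l \<noteq> 1\<close> by (metis option.inject option.distinct(1))+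
  then have neg: "x0 = - x1" "x2 = - x3" using sq by (metis power2_eq_iff)+
  have pts: "\<delta> \<noteq> 0" "\<beta> = x0 * \<delta>" "\<gamma> \<noteq> 0" "\<alpha> = x1 * \<gamma>"
      "\<alpha> * l + \<beta> = x2 * (\<gamma> * l + \<delta>)" "\<alpha> + \<beta> = x3 * (\<gamma> + \<delta>)"
    using x by (auto simp: ma(2) moebius_map_def pt_def field_simps split: if_splits)
  \<comment> \<open>In terms of \<open>t\<close>, M(z) = x1 (z - t) / (z + t).\<close>
  define t where "t = \<delta> / \<gamma>"
  have \<delta>: "\<delta> = t * \<gamma>" using pts(3) by (simp add: t_def)
  have "\<gamma> * (x1 * l - x1 * t) = \<gamma> * (- x3 * (l + t))" "\<gamma> * (x1 - x1 * t) = \<gamma> * (x3 * (1 + t))"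
    using pts(5,6) unfolding pts(2,4) neg \<delta> by (simp_all add: algebra_simps)
  then have lin: "x1 * l - x1 * t = - x3 * (l + t)" "x1 - x1 * t = x3 * (1 + t)"
    using pts(3) by (metis mult_left_cancel)+
  \<comment> \<open>Elimination of \<open>t\<close> from its values at l and 1.\<close>
  have "l * (x1 + x3)\<^sup>2 = (x1 - x3)\<^sup>2" using lin by algebra
  then have "(x1 * (x1 + x3))\<^sup>2 = (x1 - x3)\<^sup>2" using sq(2) by (simp add: power_mult_distrib)
  then have or: "x1 * (x1 + x3) = x1 - x3 \<or> x1 * (x1 + x3) = - (x1 - x3)" by (simp add: power2_eq_iff)
  \<comment> \<open>Each choice of signs gives l = -1 or (l - 1)^2 = 4 l.\<close>
  have "x3 = 1 \<or> x3 = -1" using sq(4) by (simp add: power2_eq_1_iff)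
  then show ?thesis using or
  proof (elim disjE)
    assume "x3 = 1" "x1 * (x1 + x3) = x1 - x3"
    then show ?thesis using sq(2) by algebra
  next
    assume "x3 = 1" "x1 * (x1 + x3) = - (x1 - x3)"
    then show ?thesis using sq(2) by algebra
  next
    assume "x3 = -1" "x1 * (x1 + x3) = x1 - x3"
    then show ?thesis using sq(2) by algebra
  next
    assume "x3 = -1" "x1 * (x1 + x3) = - (x1 - x3)"
    then show ?thesis using sq(2) by algebra
  qed
qed

end

section \<open>Two maps with a common iterate\<close>

locale common_iterate = F: normal_form f d A B + G: normal_form g e A' B'
  for f d A B g e A' B' +
  fixes k :: nat
  assumes k: "k \<ge> 2" and iterate_eq: "f ^^ k = g ^^ k"
begin

lemma swapped: "common_iterate g e A' B' f d A B k"
  by unfold_locales (use k iterate_eq in auto)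

text \<open>The rotation of g is absorbed by the first application of g. This is the symmetry that
  is followed down the iterates of f.\<close>

lemma f_iterate_\<rho>: "f ^^ k \<circ> G.\<rho> = f ^^ k"
proof -
  obtain j where "k = Suc j" using k by (cases k) auto
  then have "g ^^ k = g ^^ j \<circ> g" by (metis funpow_Suc_right)
  then have "g ^^ k \<circ> G.\<rho> = g ^^ k" by (auto simp: fun_eq_iff)
  then show ?thesis by (simp add: iterate_eq)
qed

lemma totally_critical_eq: "{F.v1, F.v2} \<union> F.W = {G.v1, G.v2} \<union> G.W"
  using F.totally_critical_iterate_ge_2[OF k] G.totally_critical_iterate_ge_2[OF k] iterate_eq by simp

lemma W_single: "w \<in> F.W \<Longrightarrow> F.W = {w}"
  using F.W_fibre(2) by auto

text \<open>The common totally critical set has two or three elements, according to whether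
  \<open>W\<close> is empty.\<close>

lemma unmixed_iff: "F.W = {} \<longleftrightarrow> G.W = {}"
proof -
  interpret sw: common_iterate g e A' B' f d A B k by (rule swapped)
  have card: "card ({F.v1, F.v2} \<union> F.W) = (if F.W = {} then 2 else 3)"
  proof (cases "F.W = {}")
    case False
    then obtain w where "w \<in> F.W" by blast
    then show ?thesis using W_single[of w] F.W_fibre(5)[of w] F.v_distinct by auto
  qed (use F.v_distinct in auto)
  have card': "card ({G.v1, G.v2} \<union> G.W) = (if G.W = {} then 2 else 3)"
  proof (cases "G.W = {}")
    case False
    then obtain w where "w \<in> G.W" by blast
    then show ?thesis using sw.W_single[of w] G.W_fibre(5)[of w] G.v_distinct by auto
  qed (use G.v_distinct in auto)
  show ?thesis using card card' totally_critical_eq by (auto split: if_splits)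
qed

text \<open>The rotation of g preserves the critical points of f. If it exchanged them, its square
  would fix them, so e = 2, hence d = 2, and the identity would exchange the critical values of f.
  So it fixes them, and its fixed points are the critical points of g.\<close>

lemma C_unmixed_aux:
  assumes "F.W = {}" "d = 2 \<or> e \<ge> 3"
  shows "{F.c1, F.c2} = {G.c1, G.c2}"
proof -
  obtain j where j: "k = Suc j" using k by (cases k) auto
  have sym: "f ^^ Suc j \<circ> G.\<rho> = id \<circ> f ^^ Suc j" using f_iterate_\<rho> j by simp
  have img: "G.\<rho> ` {F.c1, F.c2} = {F.c1, F.c2}"
    by (rule F.symmetry_preserves_C[OF assms(1) G.moebius_\<rho> moebius_id sym])
  have "G.\<rho> F.c1 = F.c1"
  proof (rule ccontr)
    assume "G.\<rho> F.c1 \<noteq> F.c1"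
    then have s: "G.\<rho> F.c1 = F.c2" "G.\<rho> F.c2 = F.c1" using img by (auto simp: doubleton_eq_iff)
    have "e < 3" using G.\<rho>_\<rho>_fix[of F.c1] G.\<rho>_fix[of F.c1] s F.c_distinct by fastforce
    then have "d = 2" using assms(2) by simp
    then have "id F.v1 = F.v2"
      using F.symmetry_swaps_V[OF assms(1) _ G.moebius_\<rho> s(1) moebius_id sym] by blast
    then show False using F.v_distinct by simp
  qed
  moreover from this have "G.\<rho> F.c2 = F.c2" using img F.c_distinct by (auto simp: doubleton_eq_iff)
  ultimately show ?thesis using G.\<rho>_fix F.c_distinct by (metis doubleton_eq_iff insertE singletonD)
qed

lemma C_unmixed:
  assumes "F.W = {}"
  shows "{F.c1, F.c2} = {G.c1, G.c2}"
proof (cases "d = 2 \<or> e \<ge> 3")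
  case True
  then show ?thesis using C_unmixed_aux assms by blast
next
  case False
  \<comment> \<open>Here d \<ge> 3 and e = 2, which is covered with f and g exchanged.\<close>
  then have "e = 2" using G.d_ge_2 by linarith
  then show ?thesis
    using common_iterate.C_unmixed_aux[OF swapped] assms unmixed_iff by auto
qed

text \<open>By \<open>deck_iterate\<close>, the rotation of g descends through f to a deck
  transformation \<nu> of f. As it exchanges the critical values, \<nu> fixes w, which the rotation
  of f does not. So \<nu> is the identity and the two rotations coincide.\<close>

lemma C_mixed_aux:
  assumes w: "w \<in> F.W" "w \<in> G.W" and V: "{F.v1, F.v2} = {G.v1, G.v2}" and "w \<notin> {F.c1, F.c2}"
  shows "{F.c1, F.c2} = {G.c1, G.c2}"
proof -
  note wF = F.W_fibre[OF w(1)] and wG = G.W_fibre[OF w(2)]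
  have "f ^^ 2 \<circ> G.\<rho> = f ^^ 2"
    by (rule F.deck_iterate[OF w(1) assms(4) G.moebius_\<rho> f_iterate_\<rho>])
  then have s: "f ^^ Suc 1 \<circ> G.\<rho> = id \<circ> f ^^ Suc 1" "id ` {F.v1, F.v2} = {F.v1, F.v2}"
    by (simp_all only: numeral_2_eq_2 One_nat_def id_comp image_id id_apply)
  then obtain \<nu> where \<nu>: "moebius \<nu>" "f ^^ 1 \<circ> G.\<rho> = \<nu> \<circ> f ^^ 1" "f \<circ> \<nu> = id \<circ> f"
    using F.descend[OF G.moebius_\<rho> moebius_id] by blast
  have f: "f (G.\<rho> x) = \<nu> (f x)" for x using fun_cong[OF \<nu>(2), of x] by simp
  have "G.\<rho> F.v1 = F.v2"
    using G.quadratic_fibre[OF wG(4), of F.v1 F.v2] wG(2,3) V F.v_distinct by (auto simp: doubleton_eq_iff)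
  then have "\<nu> w = w" using f[of F.v1] wF by simp
  then have "\<nu> \<noteq> F.\<rho>" using F.\<rho>_fix assms(4) by metis
  then have "\<nu> = id" using F.quadratic_deck[OF wF(4) \<nu>(1)] \<nu>(3) by auto
  then have "f \<circ> G.\<rho> = f" using f by auto
  then have "G.\<rho> = id \<or> G.\<rho> = F.\<rho>" using F.quadratic_deck[OF wF(4) G.moebius_\<rho>] by simp
  moreover have "G.\<rho> \<noteq> id"
    using \<open>G.\<rho> F.v1 = F.v2\<close> F.v_distinct by auto
  ultimately have "G.\<rho> = F.\<rho>" by blast
  then show ?thesis using F.\<rho>_fix G.\<rho>_fix by auto
qed

text \<open>If w is critical for both maps, both rotations exchange the critical values and fix w,
  so their composition fixes three points. Otherwise the previous lemma applies to one of the
  maps.\<close>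

lemma C_mixed:
  assumes w: "w \<in> F.W" "w \<in> G.W" and V: "{F.v1, F.v2} = {G.v1, G.v2}"
  shows "{F.c1, F.c2} = {G.c1, G.c2}"
proof (cases "w \<in> {F.c1, F.c2} \<and> w \<in> {G.c1, G.c2}")
  case False
  then show ?thesis
    using C_mixed_aux[OF assms] common_iterate.C_mixed_aux[OF swapped w(2,1) V[symmetric]] by auto
next
  case True
  note wF = F.W_fibre[OF w(1)] and wG = G.W_fibre[OF w(2)]
  have F: "F.\<rho> F.v1 = F.v2" "F.\<rho> F.v2 = F.v1"
    using F.quadratic_fibre[OF wF(4)] wF(2,3) F.v_distinct by metis+
  have "g F.v1 = w" "g F.v2 = w" using wG(2,3) V by (auto simp: doubleton_eq_iff)
  then have G: "G.\<rho> F.v1 = F.v2" "G.\<rho> F.v2 = F.v1"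
    using G.quadratic_fibre[OF wG(4)] F.v_distinct by metis+
  have "F.\<rho> w = w" "G.\<rho> w = w" using True F.\<rho>_fix G.\<rho>_fix by auto
  then have "G.\<rho> \<circ> F.\<rho> = id"
    using F G wF(5) F.v_distinct
    by (intro moebius_fix3[of _ F.v1 F.v2 w] moebius_comp G.moebius_\<rho> F.moebius_\<rho>) auto
  then have *: "G.\<rho> (F.\<rho> x) = x" for x by (metis comp_apply id_apply)
  have "x \<in> {G.c1, G.c2}" if "x \<in> {F.c1, F.c2}" for x
    using *[of x] that F.\<rho>_fix G.\<rho>_fix by metis
  then have "F.c1 \<in> {G.c1, G.c2}" "F.c2 \<in> {G.c1, G.c2}" by blast+
  then show ?thesis using F.c_distinct by (metis doubleton_eq_iff insertE singletonD)
qed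

text \<open>Here f sends a and b to w, while g sends a and w to b. The latter gives f^k(w) = f^k(a)
  = p, so p is fixed by f. It remains to see that w reaches p in one step.\<close>

lemma exchanged_orbit:
  assumes V: "{F.v1, F.v2} = {a, b}" "{G.v1, G.v2} = {a, w}" and W: "w \<in> F.W" "b \<in> G.W"
  shows "f w = (f ^^ k) a" "f ((f ^^ k) a) = (f ^^ k) a"
proof -
  note wF = F.W_fibre[OF W(1)] and wG = G.W_fibre[OF W(2)]
  define p where "p = (f ^^ k) a"
  have fa: "f a = w" "f b = w" using wF(2,3) V(1) by (auto simp: doubleton_eq_iff)
  have ga: "g a = b" "g w = b" using wG(2,3) V(2) by (auto simp: doubleton_eq_iff)
  have aw: "a \<noteq> w" "a \<noteq> b" using V F.v_distinct G.v_distinct by auto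
  obtain j where j: "k = Suc j" using k by (cases k) auto
  have "(f ^^ k) a = (g ^^ j) (g a)" using iterate_eq j by (simp add: funpow_swap1)
  moreover have "(f ^^ k) w = (g ^^ j) (g w)" using iterate_eq j by (simp add: funpow_swap1)
  ultimately have Fw: "(f ^^ k) w = p" using ga p_def by simp
  have "f p = (f ^^ k) (f a)" unfolding p_def by (rule funpow_swap1)
  then have fp: "f p = p" using fa Fw by simp
  \<comment> \<open>If w were critical, it would lie on a 2-cycle and never reach a fixed
    point.\<close>
  have "w \<notin> {F.c1, F.c2}"
  proof
    assume "w \<in> {F.c1, F.c2}"
    then have fw_V: "f w \<in> {F.v1, F.v2}" using F.f_in_V by blast
    then have "f w = a \<or> f w = b" unfolding V(1) by blast
    then have fw: "f (f w) = w" "f w \<noteq> w" using fa fw_V wF(5) by metis+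
    have "(f ^^ i) w \<in> {w, f w}" for i by (induction i) (auto simp: fw)
    then have "p = w \<or> p = f w" using Fw by blast
    then show False using fp fw by auto
  qed
  \<comment> \<open>The rotation of g sends a to w and is a symmetry of f^2, so f(f(w)) = f(f(a)) =
    f(w).\<close>
  then have "f ^^ 2 \<circ> G.\<rho> = f ^^ 2"
    using F.deck_iterate[OF W(1) _ G.moebius_\<rho> f_iterate_\<rho>] by blast
  then have "f (f (G.\<rho> a)) = f (f a)" by (metis comp_apply funpow_0 funpow_Suc_right numeral_2_eq_2)
  moreover have "G.\<rho> a = w" using G.quadratic_fibre[OF wG(4), of a w] ga aw by auto
  ultimately have ffw: "f (f w) = f w" using fa by simp
  have "(f ^^ i) (f w) = f w" for i by (induction i) (auto simp: ffw)
  then have "f w = p" using Fw j by (metis funpow_Suc_right comp_apply)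
  then show "f w = (f ^^ k) a" "f ((f ^^ k) a) = (f ^^ k) a" using fp p_def by auto
qed

text \<open>Both f and g satisfy \<open>cross_ratio_equation\<close>, with the same a and p but with
  b and w exchanged.\<close>

lemma V_not_exchanged:
  assumes V: "{F.v1, F.v2} = {a, b}" "{G.v1, G.v2} = {a, w}" and W: "w \<in> F.W" "b \<in> G.W"
  shows False
proof -
  note wF = F.W_fibre[OF W(1)] and wG = G.W_fibre[OF W(2)]
  define p where "p = (f ^^ k) a"
  have f: "f w = p" "f p = p" using exchanged_orbit[OF assms] p_def by auto
  have g: "g b = p" "g p = p"
    using common_iterate.exchanged_orbit[OF swapped V(2,1) W(2,1)] p_def iterate_eq by auto
  have fa: "f a = w" "f b = w" using wF(2,3) V(1) by (auto simp: doubleton_eq_iff)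
  have ga: "g a = b" "g w = b" using wG(2,3) V(2) by (auto simp: doubleton_eq_iff)
  have "a \<noteq> b" "a \<noteq> w" "b \<noteq> w" using V F.v_distinct G.v_distinct wF(5) by auto
  have "w \<noteq> p"
  proof
    assume "w = p"
    then have "w \<in> f -` {w}" using f by simp
    then show False using wF(1,5) by blast
  qed
  then have "p \<noteq> a" "p \<noteq> b" using f fa by auto
  obtain S where S: "moebius S" "S a = Some 0" "S b = None" "S p = Some 1"
    using moebius_exists3[of a b p] \<open>a \<noteq> b\<close> \<open>p \<noteq> a\<close> \<open>p \<noteq> b\<close> by metis
  note inv_S = moebius_inv_simps[OF S(1)]
  obtain l where l: "S w = Some l" using S(3) inv_S(3) \<open>b \<noteq> w\<close> by (metis option.exhaust)
  have l01: "l \<noteq> 0" "l \<noteq> 1" using l S inv_S(3) \<open>a \<noteq> w\<close> \<open>w \<noteq> p\<close> by metis+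
  have 1: "(l + 1) * (l\<^sup>2 - 6 * l + 1) = 0"
    by (rule F.cross_ratio_equation[OF wF(4) V(1) fa f \<open>a \<noteq> b\<close> \<open>w \<noteq> p\<close> S l])
  \<comment> \<open>The first factor fixes 0 and 1 and sends l to infinity, which normalises the
    points for g; infinity goes to 1 - l.\<close>
  let ?S = "moebius_map (1 - l) 0 1 (- l) \<circ> S"
  have "moebius ?S" using l01 by (intro moebius_comp S(1) moebiusI) simp
  moreover have "?S a = Some 0" "?S w = None" "?S p = Some 1" "?S b = Some (1 - l)"
    using S l l01 by (auto simp: moebius_map_def pt_def)
  ultimately have "(1 - l + 1) * ((1 - l)\<^sup>2 - 6 * (1 - l) + 1) = 0"
    using G.cross_ratio_equation[OF wG(4) V(2) ga g \<open>a \<noteq> w\<close> \<open>p \<noteq> b\<close>[symmetric]] by blast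
  then have 2: "(2 - l) * (l\<^sup>2 + 4 * l - 4) = 0" by (simp add: power2_eq_square algebra_simps)
  have "l \<noteq> -1" using 2 by auto
  then have eq: "l\<^sup>2 - 6 * l + 1 = 0" using 1 by (auto simp: eq_neg_iff_add_eq_0)
  then have "l \<noteq> 2" by auto
  then have "l\<^sup>2 + 4 * l - 4 = 0" using 2 by simp
  \<comment> \<open>The two quadratics differ by 10 l - 5, so l = 1/2, which is not a root.\<close>
  moreover have "10 * l = (l\<^sup>2 + 4 * l - 4) - (l\<^sup>2 - 6 * l + 1) + 5" by simp
  ultimately have "10 * l = 5" using eq by simp
  then have l: "2 * l = 1" by simp
  have "4 * (l\<^sup>2 - 6 * l + 1) = (2 * l)\<^sup>2 - 12 * (2 * l) + 4"
    by (simp add: power2_eq_square algebra_simps)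
  then show False unfolding l eq by simp
qed

text \<open>If \<open>W\<close> is not empty, the two triples of totally critical points agree. If
  the critical values differed, b would be a critical value of f and w one of g, with the remaining
  one common: the configuration just excluded.\<close>

lemma V_eq: "{F.v1, F.v2} = {G.v1, G.v2}"
proof (cases "F.W = {}")
  case True
  then show ?thesis using totally_critical_eq unmixed_iff by simp
next
  case False
  then obtain w b where W: "w \<in> F.W" "b \<in> G.W" using unmixed_iff by blast
  have eq: "{F.v1, F.v2, w} = {G.v1, G.v2, b}"
    using totally_critical_eq W_single[OF W(1)] common_iterate.W_single[OF swapped W(2)] by auto
  have n: "w \<notin> {F.v1, F.v2}" "b \<notin> {G.v1, G.v2}" using F.W_fibre(5) G.W_fibre(5) W by blast+
  show ?thesis
  proof (rule ccontr)
    assume ne: "{F.v1, F.v2} \<noteq> {G.v1, G.v2}"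
    have "{F.v1, F.v2} = {F.v1, F.v2, w} - {w}" using n(1) by auto
    moreover have *: "{G.v1, G.v2} = {F.v1, F.v2, w} - {b}" unfolding eq using n(2) by auto
    ultimately have "w \<noteq> b" using ne by metis
    moreover have "b \<in> {F.v1, F.v2, w}" unfolding eq by simp
    ultimately consider "b = F.v1" | "b = F.v2" by auto
    then obtain a where a: "{F.v1, F.v2} = {a, b}" "a \<noteq> b"
    proof cases
      case 1
      then show thesis using that[of F.v2] F.v_distinct by (simp add: doubleton_eq_iff)
    next
      case 2
      then show thesis using that[of F.v1] F.v_distinct by simp
    qed
    have "{G.v1, G.v2} = ({F.v1, F.v2} \<union> {w}) - {b}" unfolding * by auto
    also have "\<dots> = {a, b} \<union> {w} - {b}" unfolding a(1) ..
    also have "\<dots> = {a, w}" using a \<open>w \<noteq> b\<close> by auto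
    finally show False using V_not_exchanged a(1) W by blast
  qed
qed

lemma C_eq: "{F.c1, F.c2} = {G.c1, G.c2}"
proof (cases "F.W = {}")
  case True
  then show ?thesis by (rule C_unmixed)
next
  case False
  then obtain w b where W: "w \<in> F.W" "b \<in> G.W" using unmixed_iff by blast
  have "{F.v1, F.v2} \<union> {w} = {F.v1, F.v2} \<union> {b}"
    using totally_critical_eq W_single[OF W(1)] common_iterate.W_single[OF swapped W(2)] V_eq by auto
  moreover have "w \<notin> {F.v1, F.v2}" "b \<notin> {F.v1, F.v2}"
    using F.W_fibre(5) G.W_fibre(5) W V_eq by blast+
  ultimately have "w = b" by blast
  then show ?thesis using C_mixed W V_eq by blast
qed

end

theorem theorem1:
  fixes f g :: "sphere \<Rightarrow> sphere" and k :: nat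
  assumes "bicritical f" and "bicritical g" and "f \<noteq> g"
    and "k \<ge> 1" and "f ^^ k = g ^^ k"
  shows "crit_points f = crit_points g \<and> crit_values f = crit_values g"
proof -
  obtain d A B where F: "d \<ge> 2" "moebius A" "moebius B" "f = A \<circ> sphere_pow d \<circ> B"
    using bicritical_normal_form assms(1) by blast
  obtain e A' B' where G: "e \<ge> 2" "moebius A'" "moebius B'" "g = A' \<circ> sphere_pow e \<circ> B'"
    using bicritical_normal_form assms(2) by blast
  \<comment> \<open>As f and g differ, k is at least 2, where the totally critical set of the
    iterate is all of \<open>{v1, v2} \<union> W\<close>.\<close>
  have "k \<noteq> 1" using assms(3,5) by auto
  then have "k \<ge> 2" using assms(4) by simp
  then interpret common_iterate f d A B g e A' B' k
    using F G assms(5) by unfold_locales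
  show ?thesis
    using C_eq V_eq F.crit_points_eq F.crit_values_eq G.crit_points_eq G.crit_values_eq by simp
qed

end
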